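(* Let $X$ and $Y$ be $\sigma$-compact metrizable spaces, let $D$ stand either for $C$ or for $C^*$, so that $D_p(X), D_p(Y)$ are $C_p(X), C_p(Y)$ or $C_p^*(X), C_p^*(Y)$ respectively, and let $T:D_p(X)\to D_p(Y)$ be a uniformly continuous surjection which is $c$-good for some $c>0$. Then: (1) if all finite powers of $X$ are weakly infinite-dimensional, then all finite powers of $Y$ are weakly infinite-dimensional; (2) for every natural number $m\ge 2$, if all finite powers of $X$ are $(m-C)$-spaces, then all finite powers of $Y$ are $(m-C)$-spaces.
   Context: $C(X)$ (resp. $C^*(X)$) is the set of all continuous (resp. continuous and bounded) real-valued functions on $X$; $C_p(X)$ (resp. $C_p^*(X)$) is this set endowed with the topology of pointwise convergence. A map $T:D_p(X)\to D_p(Y)$ (not necessarily linear) is uniformly continuous if for every neighborhood $U$ of the zero function in $D_p(Y)$ there is a neighborhood $V$ of the zero function in $D_p(X)$ such that $f,g\in D_p(X)$ and $f-g\in V$ imply $T(f)-T(g)\in U$. For a bounded function $f$, $\|f\|$ is its supremum norm. For $c>0$, $T$ is $c$-good if for every bounded function $g\in D_p(Y)$ there is a bounded function $f\in D_p(X)$ with $T(f)=g$ and $\|f\|\le c\|g\|$. A normal space $Z$ is weakly infinite-dimensional if for every sequence $\{(A_i,B_i)\}_{i\ge1}$ of pairs of disjoint closed subsets of $Z$ there exist closed sets $L_1,L_2,\dots$ such that $L_i$ is a partition between $A_i$ and $B_i$ (i.e. $Z\setminus L_i$ is the union of two disjoint open sets, one containing $A_i$ and the other containing $B_i$) and $\bigcap_i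 L_i=\varnothing$. For a natural number $m\ge2$, a normal space $Z$ is an $(m-C)$-space if for every sequence $\{\mathcal G_i\}$ of open covers of $Z$ such that each $\mathcal G_i$ has at most $m$ elements, there is a sequence $\{\mathcal H_i\}$ of families of pairwise disjoint open subsets of $Z$ such that each member of $\mathcal H_i$ is contained in some member of $\mathcal G_i$ and $\bigcup_i\mathcal H_i$ is a cover of $Z$. *)

theory Defs
  imports "HOL-Analysis.Analysis"
begin

definition sigma_compact_space :: "'a topology \<Rightarrow> bool" where
  "sigma_compact_space X \<longleftrightarrow>
     (\<exists>K :: nat \<Rightarrow> 'a set. (\<forall>n. compactin X (K n)) \<and> (\<Union>n. K n) = topspace X)"

definition finite_power :: "'a topology \<Rightarrow> nat \<Rightarrow> (nat \<Rightarrow> 'a) topology" where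
  "finite_power X n = product_topology (\<lambda>_. X) {..<n}"

definition bounded_fun_on :: "'a topology \<Rightarrow> ('a \<Rightarrow> real) \<Rightarrow> bool" where
  "bounded_fun_on X f \<longleftrightarrow> bounded (f ` topspace X)"

(* The choice of D: C(X) or C*(X). *)
datatype fun_class = AllCont | BoundedCont

fun in_class :: "fun_class \<Rightarrow> 'a topology \<Rightarrow> ('a \<Rightarrow> real) \<Rightarrow> bool" where
  "in_class AllCont X f \<longleftrightarrow> continuous_map X euclideanreal f"
| "in_class BoundedCont X f \<longleftrightarrow> continuous_map X euclideanreal f \<and> bounded_fun_on X f"

(* D_p(X). A real function on X is represented by the HOL function that is undefined outside
   topspace X (the points of the product topology are extensional), so that equality of points
   of D_p(X) is equality of functions on X. *)
definition Dp :: "fun_class \<Rightarrow> 'a topology \<Rightarrow> ('a \<Rightarrow> real) topology" where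
  "Dp D X = subtopology (product_topology (\<lambda>_. euclideanreal) (topspace X)) {f. in_class D X f}"

definition zero_fun :: "'a topology \<Rightarrow> 'a \<Rightarrow> real" where
  "zero_fun X = (\<lambda>x\<in>topspace X. 0)"

definition diff_fun :: "'a topology \<Rightarrow> ('a \<Rightarrow> real) \<Rightarrow> ('a \<Rightarrow> real) \<Rightarrow> 'a \<Rightarrow> real" where
  "diff_fun X f g = (\<lambda>x\<in>topspace X. f x - g x)"

(* Neighbourhoods are not required to be open. *)
definition neighbourhood_in :: "'a topology \<Rightarrow> 'a \<Rightarrow> 'a set \<Rightarrow> bool" where
  "neighbourhood_in Z z U \<longleftrightarrow> U \<subseteq> topspace Z \<and> (\<exists>W. openin Z W \<and> z \<in> W \<and> W \<subseteq> U)"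

definition uniformly_continuous_Dp ::
  "fun_class \<Rightarrow> 'a topology \<Rightarrow> 'b topology \<Rightarrow> (('a \<Rightarrow> real) \<Rightarrow> ('b \<Rightarrow> real)) \<Rightarrow> bool" where
  "uniformly_continuous_Dp D X Y T \<longleftrightarrow>
     (\<forall>U. neighbourhood_in (Dp D Y) (zero_fun Y) U \<longrightarrow>
       (\<exists>V. neighbourhood_in (Dp D X) (zero_fun X) V \<and>
         (\<forall>f \<in> topspace (Dp D X). \<forall>g \<in> topspace (Dp D X).
            diff_fun X f g \<in> V \<longrightarrow> diff_fun Y (T f) (T g) \<in> U)))"

(* The inserted 0 only matters for the empty space, where the supremum norm is 0. It is used
   for bounded functions only. *)
definition sup_norm :: "'a topology \<Rightarrow> ('a \<Rightarrow> real) \<Rightarrow> real" where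
  "sup_norm X f = Sup (insert 0 ((\<lambda>x. \<bar>f x\<bar>) ` topspace X))"

definition c_good ::
  "fun_class \<Rightarrow> 'a topology \<Rightarrow> 'b topology \<Rightarrow> real \<Rightarrow> (('a \<Rightarrow> real) \<Rightarrow> ('b \<Rightarrow> real)) \<Rightarrow> bool" where
  "c_good D X Y c T \<longleftrightarrow>
     (\<forall>g \<in> topspace (Dp D Y). bounded_fun_on Y g \<longrightarrow>
       (\<exists>f \<in> topspace (Dp D X). bounded_fun_on X f \<and> T f = g \<and> sup_norm X f \<le> c * sup_norm Y g))"

definition partition_between :: "'a topology \<Rightarrow> 'a set \<Rightarrow> 'a set \<Rightarrow> 'a set \<Rightarrow> bool" where
  "partition_between Z L A B \<longleftrightarrow>
     closedin Z L \<and>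
     (\<exists>U V. openin Z U \<and> openin Z V \<and> disjnt U V \<and> A \<subseteq> U \<and> B \<subseteq> V \<and> topspace Z - L = U \<union> V)"

definition weakly_infinite_dimensional :: "'a topology \<Rightarrow> bool" where
  "weakly_infinite_dimensional Z \<longleftrightarrow>
     normal_space Z \<and>
     (\<forall>A B :: nat \<Rightarrow> 'a set.
        (\<forall>i. closedin Z (A i) \<and> closedin Z (B i) \<and> disjnt (A i) (B i)) \<longrightarrow>
        (\<exists>L :: nat \<Rightarrow> 'a set.
           (\<forall>i. partition_between Z (L i) (A i) (B i)) \<and> (\<Inter>i. L i) = {}))"

definition mC_space :: "nat \<Rightarrow> 'a topology \<Rightarrow> bool" where
  "mC_space m Z \<longleftrightarrow>
     normal_space Z \<and>
     (\<forall>G :: nat \<Rightarrow> 'a set set.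
        (\<forall>i. finite (G i) \<and> card (G i) \<le> m \<and> (\<forall>U \<in> G i. openin Z U) \<and> \<Union>(G i) = topspace Z) \<longrightarrow>
        (\<exists>H :: nat \<Rightarrow> 'a set set.
           (\<forall>i. (\<forall>U \<in> H i. openin Z U) \<and> pairwise disjnt (H i) \<and>
                (\<forall>U \<in> H i. \<exists>V \<in> G i. U \<subseteq> V)) \<and>
           \<Union>(\<Union>i. H i) = topspace Z))"

end

theory Submission
  imports Defs
begin

text \<open>
The theorem combines a decomposition of \<open>Y\<close> by finite subsets of \<open>X\<close>, going back to Gul'ko's proof
that uniform homeomorphisms of function spaces preserve dimension, with an elementary argument about
maps with finite fibres.

Say that a finite set \<open>K \<subseteq> X\<close> controls \<open>y \<in> Y\<close> with bound \<open>p\<close> if \<open>\<bar>T f y - T g y\<bar> \<le> p\<close> for all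
\<open>f\<close>, \<open>g\<close> with \<open>\<bar>f - g\<bar> < 1\<close> on \<open>K\<close>. Uniform continuity provides such a set for every \<open>y\<close>
(\<open>exists_controls\<close>), and intersecting two of them adds their bounds (\<open>controls_Int\<close>). Hence a
control of least possible size is unique (\<open>minimal_control_unique\<close>). Being a control is a closed
condition (\<open>closedin_controls\<close>), so \<open>Y\<close> is a countable union of compact sets on each of which the \<open>q\<close>
points of the control depend continuously on \<open>y\<close> and thus define a continuous map into the
power of \<open>X\<close> with exponent \<open>q\<close>. If many points shared the same control, then, \<open>T\<close> being \<open>c\<close>-good, the
functions prescribing signs at these points would come from too many uniformly bounded functions
that are far from each other on the finite set \<open>K\<close>. So the fibres of these maps are finite and of
bounded size (\<open>controlled_points_bounded\<close>). Products of such compact sets cover the powers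
of \<open>Y\<close>, and they have maps with bounded finite fibres into higher powers of \<open>X\<close>
(\<open>mC_on_product_of_parametrised\<close>).

The (m-C) property of a metrizable target is inherited by a compact metrizable space that is mapped into it
with bounded finite fibres (\<open>mC_on_bounded_fibres\<close>). One treats the points in fibres of maximal
size first: they form a countable union of compact sets on which the map is injective. Half of
the given covers is spent on them, and what remains is closed and has smaller fibres. Finally, a normal
space is weakly infinite-dimensional exactly if it is a (2-C)-space, so that the statement about weak
infinite-dimensionality is the case \<open>m = 2\<close> of the other one.
\<close>

section \<open>Relative covering property of subsets\<close>

definition disjoint_refinement :: "'a topology \<Rightarrow> 'a set set \<Rightarrow> 'a set set \<Rightarrow> bool" where
  "disjoint_refinement Z H G \<longleftrightarrow>
     (\<forall>U\<in>H. openin Z U) \<and> pairwise disjnt H \<and> (\<forall>U\<in>H. \<exists>V\<in>G. U \<subseteq> V)"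

definition small_open_cover :: "nat \<Rightarrow> 'a topology \<Rightarrow> 'a set \<Rightarrow> 'a set set \<Rightarrow> bool" where
  "small_open_cover m Z E G \<longleftrightarrow>
     finite G \<and> card G \<le> m \<and> (\<forall>U\<in>G. openin Z U) \<and> E \<subseteq> \<Union>G"

text \<open>
The (m-C) property of a subset, with covers and refinements by open sets of the ambient space.
With ambient open sets, the refinements found for several subsets can be put side by side without
any extension argument, so that unions and complements are handled by merely distributing the
indices of the sequence of covers.
\<close>

definition mC_on :: "nat \<Rightarrow> 'a topology \<Rightarrow> 'a set \<Rightarrow> bool" where
  "mC_on m Z E \<longleftrightarrow>
     (\<forall>G :: nat \<Rightarrow> 'a set set. (\<forall>i. small_open_cover m Z E (G i)) \<longrightarrow>
        (\<exists>H. (\<forall>i. disjoint_refinement Z (H i) (G i)) \<and> E \<subseteq> \<Union>(\<Union>i. H i)))"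

lemma mC_onI:
  assumes "\<And>G :: nat \<Rightarrow> 'a set set. (\<And>i. small_open_cover m Z E (G i)) \<Longrightarrow>
             \<exists>H. (\<forall>i. disjoint_refinement Z (H i) (G i)) \<and> E \<subseteq> \<Union>(\<Union>i. H i)"
  shows "mC_on m Z E"
  using assms unfolding mC_on_def by blast

lemma mC_onD:
  fixes G :: "nat \<Rightarrow> 'a set set"
  assumes "mC_on m Z E" "\<And>i. small_open_cover m Z E (G i)"
  shows "\<exists>H. (\<forall>i. disjoint_refinement Z (H i) (G i)) \<and> E \<subseteq> \<Union>(\<Union>i. H i)"
  using assms unfolding mC_on_def by blast

text \<open>
On the whole space, covering the space and being equal to it amount to the same for a family of
open sets.
\<close>

lemma mC_space_iff_mC_on:
  "mC_space m Z \<longleftrightarrow> normal_space Z \<and> mC_on m Z (topspace Z)"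
proof -
  have cov: "small_open_cover m Z (topspace Z) G \<longleftrightarrow>
      finite G \<and> card G \<le> m \<and> (\<forall>U\<in>G. openin Z U) \<and> \<Union>G = topspace Z" for G
    unfolding small_open_cover_def using openin_subset by fastforce
  have "topspace Z \<subseteq> \<Union>(\<Union>i. H i) \<longleftrightarrow> \<Union>(\<Union>i. H i) = topspace Z"
    if "\<forall>i. disjoint_refinement Z (H i) (G i)" for H G :: "nat \<Rightarrow> 'a set set"
  proof -
    have "U \<subseteq> topspace Z" if "U \<in> H i" for U i
      using \<open>\<forall>i. _\<close> that openin_subset unfolding disjoint_refinement_def by metis
    then show ?thesis by auto
  qed
  then have "(\<exists>H. (\<forall>i. disjoint_refinement Z (H i) (G i)) \<and> topspace Z \<subseteq> \<Union>(\<Union>i. H i))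
     \<longleftrightarrow> (\<exists>H. (\<forall>i. disjoint_refinement Z (H i) (G i)) \<and> \<Union>(\<Union>i. H i) = topspace Z)"
    for G :: "nat \<Rightarrow> 'a set set"
    by (intro iff_exI conj_cong refl) auto
  then show ?thesis
    unfolding mC_space_def mC_on_def cov disjoint_refinement_def by simp
qed

lemma small_open_cover_mono:
  "small_open_cover m Z E G \<Longrightarrow> E' \<subseteq> E \<Longrightarrow> small_open_cover m Z E' G"
  unfolding small_open_cover_def by blast

lemma small_open_cover_image:
  assumes "small_open_cover m Z E G" "\<And>U. U \<in> G \<Longrightarrow> openin Z' (f U)" "E' \<subseteq> \<Union>(f ` G)"
  shows "small_open_cover m Z' E' (f ` G)"
  using assms card_image_le[of G f] unfolding small_open_cover_def by auto

text \<open>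
Transporting covers from one space to another turns a cover into its image under an operation on
open sets. A refinement of the image then has to remember which member of the original cover
contains each of its sets.
\<close>

lemma disjoint_refinement_choice:
  assumes "\<And>i. disjoint_refinement Z (H i) (f ` G i)"
  shows "\<exists>v. \<forall>i. \<forall>U\<in>H i. v i U \<in> G i \<and> U \<subseteq> f (v i U)"
proof (intro exI allI ballI)
  fix i U assume "U \<in> H i"
  then have "\<exists>V. V \<in> G i \<and> U \<subseteq> f V"
    using assms[of i] unfolding disjoint_refinement_def by blast
  then show "(SOME V. V \<in> G i \<and> U \<subseteq> f V) \<in> G i \<and> U \<subseteq> f (SOME V. V \<in> G i \<and> U \<subseteq> f V)"
    by (rule someI_ex)
qed

lemma disjoint_refinement_image:
  assumes "disjoint_refinement W H K"
    and "\<And>U. U \<in> H \<Longrightarrow> openin Z (f U)"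
    and "\<And>U V. U \<in> H \<Longrightarrow> V \<in> H \<Longrightarrow> disjnt U V \<Longrightarrow> disjnt (f U) (f V)"
    and "\<And>U. U \<in> H \<Longrightarrow> \<exists>V\<in>G. f U \<subseteq> V"
  shows "disjoint_refinement Z (f ` H) G"
  unfolding disjoint_refinement_def
proof (intro conjI)
  show "pairwise disjnt (f ` H)"
  proof (rule pairwiseI)
    fix A B assume "A \<in> f ` H" "B \<in> f ` H" "A \<noteq> B"
    then obtain U V where UV: "U \<in> H" "V \<in> H" "U \<noteq> V" "A = f U" "B = f V" by blast
    then have "disjnt U V"
      using assms(1) unfolding disjoint_refinement_def by (meson pairwiseD)
    then show "disjnt A B"
      using assms(3) UV by simp
  qed
qed (use assms(2,4) in auto)

text \<open>
A cover of the closed set becomes a cover of the larger set, with at most as many members, when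
every member is enlarged by the complement. Cutting the refining sets down to the original members
keeps them disjoint and loses nothing inside the closed set.
\<close>

lemma mC_on_closed_subset:
  assumes mC: "mC_on m Z E" and clo: "closedin Z C" and "C \<subseteq> E" "E \<subseteq> topspace Z"
  shows "mC_on m Z C"
proof (cases "C = {}")
  case True
  then show ?thesis
    by (auto intro!: mC_onI exI[of _ "\<lambda>_. {}"] simp: disjoint_refinement_def)
next
  case False
  show ?thesis
  proof (rule mC_onI)
    fix G :: "nat \<Rightarrow> 'a set set" assume G: "\<And>i. small_open_cover m Z C (G i)"
    define G' where "G' i = (\<lambda>U. U \<union> (topspace Z - C)) ` G i" for i :: nat
    have "small_open_cover m Z E (G' i)" for i
      unfolding G'_def
    proof (rule small_open_cover_image[OF G[of i]])
      show "openin Z (U \<union> (topspace Z - C))" if "U \<in> G i" for U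
        using that G[of i] clo unfolding small_open_cover_def by blast
      obtain U where "U \<in> G i"
        using G[of i] False unfolding small_open_cover_def by blast
      then show "E \<subseteq> \<Union>((\<lambda>U. U \<union> (topspace Z - C)) ` G i)"
        using G[of i] \<open>E \<subseteq> topspace Z\<close> unfolding small_open_cover_def by blast
    qed
    then obtain H where H: "\<And>i. disjoint_refinement Z (H i) (G' i)" and cov: "E \<subseteq> \<Union>(\<Union>i. H i)"
      using mC_onD[OF mC, of G'] by blast
    obtain v where "\<forall>i. \<forall>U\<in>H i. v i U \<in> G i \<and> U \<subseteq> v i U \<union> (topspace Z - C)"
      using disjoint_refinement_choice[OF H[unfolded G'_def]] ..
    then have v: "v i U \<in> G i" "U \<subseteq> v i U \<union> (topspace Z - C)" if "U \<in> H i" for i U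
      using that by blast+
    define H' where "H' i = (\<lambda>U. U \<inter> v i U) ` H i" for i
    have ref: "disjoint_refinement Z (H' i) (G i)" for i
      unfolding H'_def
    proof (rule disjoint_refinement_image[OF H[of i]])
      fix U assume U: "U \<in> H i"
      show "openin Z (U \<inter> v i U)"
        using U H[of i] G[of i] v[OF U]
        unfolding disjoint_refinement_def small_open_cover_def by blast
      show "\<exists>V\<in>G i. U \<inter> v i U \<subseteq> V"
        using v[OF U] by blast
    qed (auto simp: disjnt_iff)
    have cover: "C \<subseteq> \<Union>(\<Union>i. H' i)"
    proof
      fix x assume "x \<in> C"
      then obtain i U where U: "U \<in> H i" "x \<in> U"
        using cov \<open>C \<subseteq> E\<close> by blast
      then have "U \<inter> v i U \<in> H' i" "x \<in> U \<inter> v i U"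
        using v(2)[OF U(1)] \<open>x \<in> C\<close> unfolding H'_def by auto
      then show "x \<in> \<Union>(\<Union>i. H' i)"
        by blast
    qed
    show "\<exists>H. (\<forall>i. disjoint_refinement Z (H i) (G i)) \<and> C \<subseteq> \<Union>(\<Union>i. H i)"
      using ref cover by (intro exI[of _ H']) simp
  qed
qed

text \<open>
Split the sequence of covers into infinitely many infinite subsequences by a pairing function and
spend one subsequence on each set.
\<close>

lemma mC_on_countable_Union:
  assumes "countable \<E>" "\<And>E. E \<in> \<E> \<Longrightarrow> mC_on m Z E"
  shows "mC_on m Z (\<Union>\<E>)"
proof (cases "\<E> = {}")
  case True
  then show ?thesis
    by (auto intro!: mC_onI exI[of _ "\<lambda>_. {}"] simp: disjoint_refinement_def)
next
  case False
  show ?thesis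
  proof (rule mC_onI)
    fix G :: "nat \<Rightarrow> 'a set set" assume G: "\<And>i. small_open_cover m Z (\<Union>\<E>) (G i)"
    define e where "e = from_nat_into \<E>"
    have e: "range e = \<E>"
      unfolding e_def using False assms(1) by (rule range_from_nat_into)
    have "\<exists>H. (\<forall>n. disjoint_refinement Z (H n) (G (prod_encode (j, n)))) \<and> e j \<subseteq> \<Union>(\<Union>n. H n)" for j
    proof -
      have "mC_on m Z (e j)" using e assms(2) by blast
      moreover have "small_open_cover m Z (e j) (G (prod_encode (j, n)))" for n
        using G e by (blast intro: small_open_cover_mono)
      ultimately show ?thesis
        by (rule mC_onD)
    qed
    then obtain H where H: "\<And>j n. disjoint_refinement Z (H j n) (G (prod_encode (j, n)))"
        and cov: "\<And>j. e j \<subseteq> \<Union>(\<Union>n. H j n)"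
      by metis
    define H' where "H' i = (case prod_decode i of (j, n) \<Rightarrow> H j n)" for i
    have ref: "disjoint_refinement Z (H' i) (G i)" for i
      using H[of "fst (prod_decode i)" "snd (prod_decode i)"]
      unfolding H'_def by (simp add: case_prod_unfold)
    have H'_enc: "H' (prod_encode (j, n)) = H j n" for j n
      unfolding H'_def by simp
    have cover: "\<Union>\<E> \<subseteq> \<Union>(\<Union>i. H' i)"
    proof
      fix x assume "x \<in> \<Union>\<E>"
      then obtain j n U where "x \<in> U" "U \<in> H j n"
        using cov unfolding e[symmetric] by blast
      then show "x \<in> \<Union>(\<Union>i. H' i)"
        by (metis H'_enc UN_I UNIV_I UnionI)
    qed
    show "\<exists>H. (\<forall>i. disjoint_refinement Z (H i) (G i)) \<and> \<Union>\<E> \<subseteq> \<Union>(\<Union>i. H i)"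
      using ref cover by (intro exI[of _ H']) simp
  qed
qed

text \<open>
Spend the covers of even index on \<open>E\<close>. The points of \<open>F\<close> that remain uncovered form a
closed set disjoint from \<open>E\<close>, on which the covers of odd index are spent. This serves sets
\<open>E\<close> whose complement \<open>F - E\<close> cannot be expected to be a countable union of closed sets, where
\<open>mC_on_countable_Union\<close> does not suffice.
\<close>

lemma mC_on_addition:
  assumes E: "mC_on m Z E" and "E \<subseteq> F" and F: "closedin Z F"
    and rest: "\<And>P. closedin Z P \<Longrightarrow> P \<subseteq> F - E \<Longrightarrow> mC_on m Z P"
  shows "mC_on m Z F"
proof (rule mC_onI)
  fix G :: "nat \<Rightarrow> 'a set set" assume G: "\<And>i. small_open_cover m Z F (G i)"
  have "small_open_cover m Z E (G (2 * i))" for i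
    using G \<open>E \<subseteq> F\<close> by (blast intro: small_open_cover_mono)
  then obtain H0 where H0: "\<And>i. disjoint_refinement Z (H0 i) (G (2 * i))"
      and cov0: "E \<subseteq> \<Union>(\<Union>i. H0 i)"
    using mC_onD[OF E, of "\<lambda>i. G (2 * i)"] by blast
  define P where "P = F - \<Union>(\<Union>i. H0 i)"
  have "openin Z (\<Union>(\<Union>i. H0 i))"
    using H0 unfolding disjoint_refinement_def by blast
  then have P: "mC_on m Z P"
    unfolding P_def using F cov0 by (intro rest) (auto intro: closedin_diff)
  have "small_open_cover m Z P (G (2 * i + 1))" for i
    using G unfolding P_def by (blast intro: small_open_cover_mono)
  then obtain H1 where H1: "\<And>i. disjoint_refinement Z (H1 i) (G (2 * i + 1))"
      and cov1: "P \<subseteq> \<Union>(\<Union>i. H1 i)"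
    using mC_onD[OF P, of "\<lambda>i. G (2 * i + 1)"] by blast
  define H where "H i = (if even i then H0 (i div 2) else H1 (i div 2))" for i
  have ref: "disjoint_refinement Z (H i) (G i)" for i
    unfolding H_def using H0[of "i div 2"] H1[of "i div 2"] by (cases "even i") auto
  have H_eq: "H (2 * i) = H0 i" "H (2 * i + 1) = H1 i" for i
    unfolding H_def by auto
  have cover: "F \<subseteq> \<Union>(\<Union>i. H i)"
  proof
    fix x assume "x \<in> F"
    then have "(\<exists>i. x \<in> \<Union>(H0 i)) \<or> (\<exists>i. x \<in> \<Union>(H1 i))"
      using cov1 unfolding P_def by auto
    then obtain j where "x \<in> \<Union>(H j)"
      unfolding H_eq[symmetric] by metis
    then show "x \<in> \<Union>(\<Union>i. H i)"
      by auto
  qed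
  show "\<exists>H. (\<forall>i. disjoint_refinement Z (H i) (G i)) \<and> F \<subseteq> \<Union>(\<Union>i. H i)"
    using ref cover by (intro exI[of _ H]) simp
qed

text \<open>
In a metric space, disjoint relatively open subsets of a subspace extend to disjoint open sets, by
one operation applied to each of them separately: around each point put the ball of half the radius
of a ball whose trace lies in the set. If two such half-balls met, the centre of one of them would
lie in the full ball around the other.
\<close>

lemma disjoint_open_expansion:
  assumes "metrizable_space Z" "F \<subseteq> topspace Z"
  obtains ex where
    "\<And>U. openin Z (ex U)"
    "\<And>U. openin (subtopology Z F) U \<Longrightarrow> U \<subseteq> ex U"
    "\<And>U V. U \<subseteq> F \<Longrightarrow> V \<subseteq> F \<Longrightarrow> disjnt U V \<Longrightarrow> disjnt (ex U) (ex V)"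
proof -
  obtain M d where "Metric_space M d" and Z: "Z = Metric_space.mtopology M d"
    using assms(1) unfolding metrizable_space_def by blast
  interpret Metric_space M d by fact
  define ex where "ex U = \<Union>{mball u (r / 2) | u r. u \<in> U \<and> 0 < r \<and> mball u r \<inter> F \<subseteq> U}" for U
  show thesis
  proof
    show "openin Z (ex U)" for U
      unfolding ex_def Z by blast
    show "U \<subseteq> ex U" if U: "openin (subtopology Z F) U" for U
    proof
      fix u assume "u \<in> U"
      obtain W where W: "openin mtopology W" "U = W \<inter> F"
        using U unfolding Z openin_subtopology by blast
      then obtain r where "r > 0" "mball u r \<subseteq> W"
        using \<open>u \<in> U\<close> unfolding openin_mtopology by blast
      moreover have "u \<in> M"
        using W \<open>u \<in> U\<close> openin_subset by fastforce
      ultimately show "u \<in> ex U"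
        using \<open>u \<in> U\<close> W unfolding ex_def by (force intro!: exI[of _ "mball u (r / 2)"])
    qed
    show "disjnt (ex U) (ex V)" if UV: "U \<subseteq> F" "V \<subseteq> F" "disjnt U V" for U V
    proof (rule ccontr)
      assume "\<not> disjnt (ex U) (ex V)"
      then obtain z u r v s where uv: "u \<in> U" "0 < r" "mball u r \<inter> F \<subseteq> U" "z \<in> mball u (r / 2)"
          "v \<in> V" "0 < s" "mball v s \<inter> F \<subseteq> V" "z \<in> mball v (s / 2)"
        unfolding ex_def disjnt_iff by blast
      then have "u \<in> M" "v \<in> M" "z \<in> M" "d u z < r / 2" "d v z < s / 2" by auto
      moreover have "d u v \<le> d u z + d v z"
        using triangle[of u z v] commute[of z v] calculation by simp
      ultimately have "d u v < r \<or> d v u < s"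
        using commute[of v u] by linarith
      then have "v \<in> mball u r \<or> u \<in> mball v s"
        using \<open>u \<in> M\<close> \<open>v \<in> M\<close> by auto
      then show False
        using uv UV unfolding disjnt_iff by blast
    qed
  qed
qed

text \<open>
The restriction of \<open>\<phi>\<close> to the compact set is a homeomorphism onto its image. So covers can be
pushed forward, and disjoint refinements pulled back to relatively open sets, which are then
expanded to open sets of the ambient space.
\<close>

lemma mC_on_injective_preimage:
  fixes Z :: "'a topology" and W :: "'b topology"
  assumes Z: "metrizable_space Z" and W: "Hausdorff_space W"
    and F: "compactin Z F" and \<phi>: "continuous_map (subtopology Z F) W \<phi>" and inj: "inj_on \<phi> F"
    and mC: "mC_on m W (\<phi> ` F)"
  shows "mC_on m Z F"
proof (rule mC_onI)
  fix G :: "nat \<Rightarrow> 'a set set" assume G: "\<And>i. small_open_cover m Z F (G i)"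
  have FZ: "F \<subseteq> topspace Z"
    using F compactin_subset_topspace by blast
  have \<phi>F: "\<phi> ` F \<subseteq> topspace W"
    using \<phi> FZ by (auto simp: continuous_map_def)
  \<comment> \<open>an open set whose trace on the image of the compact set is the image of the trace of U\<close>
  define push where "push U = topspace W - \<phi> ` (F - U)" for U
  have push_open: "openin W (push U)" if "openin Z U" for U
  proof -
    have "compactin Z (F - U)"
      using F that FZ by (metis compact_Int_closedin closedin_diff closedin_topspace inf.absorb_iff1 Int_Diff)
    then have "compactin (subtopology Z F) (F - U)"
      by (simp add: compactin_subtopology)
    then have "closedin W (\<phi> ` (F - U))"
      using \<phi> W image_compactin compactin_imp_closedin by blast
    then show ?thesis
      unfolding push_def by blast
  qed
  have push_iff: "\<phi> y \<in> push U \<longleftrightarrow> y \<in> U" if "y \<in> F" for y U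
    using that inj \<phi>F unfolding push_def inj_on_def by blast
  define G' where "G' i = push ` G i" for i :: nat
  have "small_open_cover m W (\<phi> ` F) (G' i)" for i
    unfolding G'_def
  proof (rule small_open_cover_image[OF G[of i]])
    show "openin W (push U)" if "U \<in> G i" for U
      using that G[of i] push_open unfolding small_open_cover_def by blast
    show "\<phi> ` F \<subseteq> \<Union>(push ` G i)"
      using G[of i] push_iff unfolding small_open_cover_def by blast
  qed
  then obtain H where H: "\<And>i. disjoint_refinement W (H i) (G' i)" and cov: "\<phi> ` F \<subseteq> \<Union>(\<Union>i. H i)"
    using mC_onD[OF mC, of G'] by blast
  obtain v where "\<forall>i. \<forall>U\<in>H i. v i U \<in> G i \<and> U \<subseteq> push (v i U)"
    using disjoint_refinement_choice[OF H[unfolded G'_def]] ..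
  then have v: "v i U \<in> G i" "U \<subseteq> push (v i U)" if "U \<in> H i" for i U
    using that by blast+
  obtain ex where ex: "\<And>U. openin Z (ex U)"
    "\<And>U. openin (subtopology Z F) U \<Longrightarrow> U \<subseteq> ex U"
    "\<And>U V. U \<subseteq> F \<Longrightarrow> V \<subseteq> F \<Longrightarrow> disjnt U V \<Longrightarrow> disjnt (ex U) (ex V)"
    using disjoint_open_expansion[OF Z FZ] by blast
  define pull where "pull U = {y \<in> F. \<phi> y \<in> U}" for U
  have pullF: "pull U \<subseteq> F" for U
    unfolding pull_def by blast
  have pull_open: "openin (subtopology Z F) (pull U)" if "openin W U" for U
    using openin_continuous_map_preimage[OF \<phi> that] FZ unfolding pull_def
    by (simp add: inf.absorb2)
  define H' where "H' i = (\<lambda>U. ex (pull U) \<inter> v i U) ` H i" for i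
  have ref: "disjoint_refinement Z (H' i) (G i)" for i
    unfolding H'_def
  proof (rule disjoint_refinement_image[OF H[of i]])
    fix U V :: "'b set" assume "disjnt U V"
    then have "disjnt (pull U) (pull V)"
      unfolding pull_def disjnt_iff by blast
    then have "disjnt (ex (pull U)) (ex (pull V))"
      using ex(3)[of "pull U" "pull V"] pullF by blast
    then show "disjnt (ex (pull U) \<inter> v i U) (ex (pull V) \<inter> v i V)"
      by (auto simp: disjnt_iff)
  next
    fix U assume U: "U \<in> H i"
    show "openin Z (ex (pull U) \<inter> v i U)"
      using ex(1) G[of i] v[OF U] unfolding small_open_cover_def by blast
    show "\<exists>V\<in>G i. ex (pull U) \<inter> v i U \<subseteq> V"
      using v[OF U] by blast
  qed
  have cover: "F \<subseteq> \<Union>(\<Union>i. H' i)"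
  proof
    fix y assume "y \<in> F"
    then obtain i U where U: "U \<in> H i" "\<phi> y \<in> U"
      using cov by blast
    then have "y \<in> ex (pull U)"
      using \<open>y \<in> F\<close> ex(2)[OF pull_open, of U] H[of i]
      unfolding disjoint_refinement_def pull_def by blast
    moreover have "y \<in> v i U"
      using U v(2)[OF U(1)] push_iff \<open>y \<in> F\<close> by auto
    moreover have "ex (pull U) \<inter> v i U \<in> H' i"
      using U unfolding H'_def by auto
    ultimately show "y \<in> \<Union>(\<Union>i. H' i)"
      by blast
  qed
  show "\<exists>H. (\<forall>i. disjoint_refinement Z (H i) (G i)) \<and> F \<subseteq> \<Union>(\<Union>i. H i)"
    using ref cover by (intro exI[of _ H']) simp
qed


section \<open>Maps with fibres of bounded finite cardinality\<close>

text \<open>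
The closed balls of radius \<open>1 / (n + 1)\<close> around a finite net, for all \<open>n\<close>, are countably many
compact sets by which the points of any finite set can be separated.
\<close>

lemma separating_compact_family:
  assumes "metrizable_space Z" "compactin Z F"
  shows "\<exists>\<B>. countable \<B> \<and> (\<forall>B\<in>\<B>. compactin Z B \<and> B \<subseteq> F) \<and>
    (\<forall>A. finite A \<and> A \<subseteq> F \<longrightarrow>
       (\<exists>b. (\<forall>y\<in>A. b y \<in> \<B> \<and> y \<in> b y) \<and> (\<forall>y\<in>A. \<forall>y'\<in>A. y \<noteq> y' \<longrightarrow> disjnt (b y) (b y'))))"
proof -
  obtain M d where "Metric_space M d" and Z: "Z = Metric_space.mtopology M d"
    using assms(1) unfolding metrizable_space_def by blast
  interpret Metric_space M d by fact
  have FM: "F \<subseteq> M"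
    using assms(2) compactin_subset_topspace unfolding Z by fastforce
  have "\<exists>C. finite C \<and> C \<subseteq> F \<and> F \<subseteq> (\<Union>x\<in>C. mball x (1 / Suc n))" for n
  proof -
    have "F \<subseteq> \<Union>((\<lambda>x. mball x (1 / Suc n)) ` F)"
      using FM by force
    then obtain \<F> where "finite \<F>" "\<F> \<subseteq> (\<lambda>x. mball x (1 / Suc n)) ` F" "F \<subseteq> \<Union>\<F>"
      using compactinD[OF assms(2)] unfolding Z by (metis (no_types, lifting) imageE openin_mball)
    then show ?thesis
      by (metis finite_subset_image)
  qed
  then obtain C where C: "\<And>n. finite (C n)" "\<And>n. C n \<subseteq> F" "\<And>n. F \<subseteq> (\<Union>x\<in>C n. mball x (1 / Suc n))"
    by metis
  define \<B> where "\<B> = (\<Union>n. (\<lambda>x. F \<inter> mcball x (1 / Suc n)) ` C n)"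
  show ?thesis
  proof (intro exI[of _ \<B>] conjI ballI allI impI)
    show "countable \<B>"
      unfolding \<B>_def using C(1) by (auto intro: countable_finite)
    show "compactin Z B" "B \<subseteq> F" if "B \<in> \<B>" for B
      using that assms(2) compact_Int_closedin unfolding \<B>_def Z by auto
    fix A assume "finite A \<and> A \<subseteq> F"
    then have A: "finite A" "A \<subseteq> F" by auto
    define S where "S = insert 1 ((\<lambda>(y, y'). d y y') ` {(y, y'). y \<in> A \<and> y' \<in> A \<and> y \<noteq> y'})"
    have "finite {(y, y'). y \<in> A \<and> y' \<in> A \<and> y \<noteq> y'}"
      by (rule finite_subset[of _ "A \<times> A"]) (use A in auto)
    then have "finite S"
      unfolding S_def by blast
    moreover have "s > 0" if "s \<in> S" for s
      using that A FM unfolding S_def by (auto simp: subset_iff)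
    ultimately have "Min S > 0"
      unfolding S_def by (subst Min_gr_iff) auto
    then obtain n where n: "1 / Suc n < Min S / 2"
      using nat_approx_posE[of "Min S / 2"] by auto
    \<comment> \<open>the balls used for separation have radius 1 / (2n + 2), so two points of one ball are at distance at most 1 / (n + 1)\<close>
    have sep: "2 / Suc n < d y y'" if "y \<in> A" "y' \<in> A" "y \<noteq> y'" for y y'
    proof -
      have "Min S \<le> d y y'"
        using that \<open>finite S\<close> unfolding S_def by (intro Min_le) auto
      moreover have "2 / Suc n = 2 * (1 / Suc n)"
        by simp
      ultimately show ?thesis using n by linarith
    qed
    have "\<exists>x. x \<in> C (2 * n + 1) \<and> y \<in> mball x (1 / Suc (2 * n + 1))" if "y \<in> A" for y
      using C(3)[of "2 * n + 1"] A that by blast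
    then obtain x where x: "\<And>y. y \<in> A \<Longrightarrow> x y \<in> C (2 * n + 1)"
       "\<And>y. y \<in> A \<Longrightarrow> y \<in> mball (x y) (1 / Suc (2 * n + 1))"
      by metis
    define b where "b y = F \<inter> mcball (x y) (1 / Suc (2 * n + 1))" for y
    have "b y \<in> \<B>" if "y \<in> A" for y
      unfolding \<B>_def b_def using x(1)[OF that] by blast
    moreover have "y \<in> b y" if "y \<in> A" for y
      unfolding b_def using x(2)[OF that] that A mball_subset_mcball by blast
    moreover have "disjnt (b y) (b y')" if "y \<in> A" "y' \<in> A" "y \<noteq> y'" for y y'
    proof (rule ccontr)
      assume "\<not> disjnt (b y) (b y')"
      then obtain z where z: "z \<in> b y" "z \<in> b y'"
        unfolding disjnt_iff by blast
      have "y \<in> b y" "y' \<in> b y'"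
        unfolding b_def using x(2) that A mball_subset_mcball by blast+
      then have "d y z \<le> 2 / Suc (2 * n + 1)" "d y' z \<le> 2 / Suc (2 * n + 1)"
        using z triangle[of y "x y" z] triangle[of y' "x y'" z] commute[of "x y" y] commute[of "x y'" y']
        unfolding b_def by auto
      moreover have "d y y' \<le> d y z + d y' z"
        using z that A FM triangle[of y z y'] commute[of z y'] unfolding b_def by auto
      ultimately have "d y y' \<le> 4 / Suc (2 * n + 1)"
        by simp
      also have "4 / Suc (2 * n + 1) = 2 / Suc n"
        by (simp add: field_simps)
      finally show False
        using sep[OF that] by simp
    qed
    ultimately show "\<exists>b. (\<forall>y\<in>A. b y \<in> \<B> \<and> y \<in> b y) \<and>
        (\<forall>y\<in>A. \<forall>y'\<in>A. y \<noteq> y' \<longrightarrow> disjnt (b y) (b y'))"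
      by (intro exI[of _ b]) simp
  qed
qed

text \<open>
Induction on the bound \<open>k + 1\<close> of the fibre size. Let \<open>E\<close> be the set of points that lie in a fibre
with exactly \<open>k + 1\<close> points. Separate the points of such a fibre by \<open>k + 1\<close> disjoint compact sets
of a countable family. A fibre that meets all of these sets has exactly one point in each of them,
so the map is injective on the part of each of these sets formed by such fibres, and this part is
compact. Thus \<open>E\<close> is a countable union of compact sets on which the map is injective. On a closed set
disjoint from \<open>E\<close> the fibres have at most \<open>k\<close> points, so the induction hypothesis and
\<open>mC_on_addition\<close> finishes the step.
\<close>

lemma mC_on_bounded_fibres:
  fixes Z :: "'a topology" and W :: "'b topology"
  assumes Z: "metrizable_space Z" and W: "Hausdorff_space W" and mC: "mC_on m W (topspace W)"
    and "compactin Z F" and "continuous_map (subtopology Z F) W \<phi>"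
    and "\<And>y. y \<in> F \<Longrightarrow> finite {y' \<in> F. \<phi> y' = \<phi> y} \<and> card {y' \<in> F. \<phi> y' = \<phi> y} \<le> k"
  shows "mC_on m Z F"
  using assms(4-)
proof (induction k arbitrary: F)
  case 0
  have "F = {}"
    using 0(3) by fastforce
  then show ?case
    using mC_on_countable_Union[of "{}" m Z] by simp
next
  case (Suc k)
  note F = Suc.prems(1) and \<phi> = Suc.prems(2)
  have FZ: "F \<subseteq> topspace Z"
    using F compactin_subset_topspace by blast
  have cloF: "closedin Z F"
    using F Z compactin_imp_closedin metrizable_imp_Hausdorff_space by blast
  have img: "closedin W (\<phi> ` B)" if "compactin Z B" "B \<subseteq> F" for B
  proof -
    have "compactin (subtopology Z F) B"
      using that by (simp add: compactin_subtopology)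
    then show ?thesis
      using compactin_imp_closedin[OF W] image_compactin[OF _ \<phi>] by blast
  qed
  obtain \<B> where "countable \<B>"
    and \<B>: "\<forall>B\<in>\<B>. compactin Z B \<and> B \<subseteq> F"
    and sep: "\<forall>A. finite A \<and> A \<subseteq> F \<longrightarrow> (\<exists>b. (\<forall>y\<in>A. b y \<in> \<B> \<and> y \<in> b y) \<and>
       (\<forall>y\<in>A. \<forall>y'\<in>A. y \<noteq> y' \<longrightarrow> disjnt (b y) (b y')))"
    using separating_compact_family[OF Z F] by (elim exE conjE) (rule that)
  \<comment> \<open>the families of disjoint compact sets that a fibre with k + 1 points may meet in all their members\<close>
  define full where "full \<F> \<longleftrightarrow> finite \<F> \<and> \<F> \<subseteq> \<B> \<and> card \<F> = Suc k \<and> pairwise disjnt \<F>" for \<F>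
  define piece where "piece = (\<lambda>(\<F>, B). {y \<in> B. \<forall>C\<in>\<F>. \<phi> y \<in> \<phi> ` C})"
  define \<E> where "\<E> = piece ` {(\<F>, B). full \<F> \<and> B \<in> \<F>}"
  have "countable \<E>"
  proof -
    have "countable ({\<F>. finite \<F> \<and> \<F> \<subseteq> \<B>} \<times> \<B>)"
      using \<open>countable \<B>\<close> by (intro countable_SIGMA countable_Collect_finite_subset)
    moreover have "{(\<F>, B). full \<F> \<and> B \<in> \<F>} \<subseteq> {\<F>. finite \<F> \<and> \<F> \<subseteq> \<B>} \<times> \<B>"
      unfolding full_def by auto
    ultimately show ?thesis
      unfolding \<E>_def using countable_subset by blast
  qed
  have piece_mC: "mC_on m Z (piece (\<F>, B)) \<and> piece (\<F>, B) \<subseteq> F" if \<F>: "full \<F>" and B: "B \<in> \<F>" for \<F> B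
  proof -
    define P where "P = piece (\<F>, B)"
    have BF: "compactin Z B" "B \<subseteq> F"
      using \<B> that unfolding full_def by blast+
    have P_eq: "P = B \<inter> {y \<in> F. \<phi> y \<in> (\<Inter>C\<in>\<F>. \<phi> ` C)}"
      using BF unfolding P_def piece_def by auto
    have "closedin W (\<Inter>C\<in>\<F>. \<phi> ` C)"
      using B \<F> \<B> img unfolding full_def by (intro closedin_INT) auto
    from closedin_continuous_map_preimage[OF \<phi> this]
    have "closedin (subtopology Z F) {y \<in> F. \<phi> y \<in> (\<Inter>C\<in>\<F>. \<phi> ` C)}"
      by (simp only: topspace_subtopology_subset[OF FZ])
    then have "closedin Z {y \<in> F. \<phi> y \<in> (\<Inter>C\<in>\<F>. \<phi> ` C)}"
      using cloF closedin_trans_full by blast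
    then have P: "compactin Z P"
      unfolding P_eq using BF(1) compact_Int_closedin by blast
    have PF: "P \<subseteq> F"
      unfolding P_eq by blast
    have "inj_on \<phi> P"
    proof (rule inj_onI, rule ccontr)
      fix y y' assume y: "y \<in> P" "y' \<in> P" "\<phi> y = \<phi> y'" "y \<noteq> y'"
      \<comment> \<open>a point of the fibre in each of the k other sets, together with y and y', gives k + 2 points in one fibre\<close>
      have "\<exists>z. z \<in> C \<and> \<phi> z = \<phi> y" if "C \<in> \<F>" for C
        using y(1) that unfolding P_eq by force
      then obtain z where z: "\<And>C. C \<in> \<F> \<Longrightarrow> z C \<in> C \<and> \<phi> (z C) = \<phi> y"
        by metis
      have dis: "disjnt C C'" if "C \<in> \<F>" "C' \<in> \<F>" "C \<noteq> C'" for C C'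
        using that \<F> unfolding full_def pairwise_def by blast
      have "inj_on z (\<F> - {B})"
      proof (rule inj_onI, rule ccontr)
        fix C C' assume C: "C \<in> \<F> - {B}" "C' \<in> \<F> - {B}" "z C = z C'" "C \<noteq> C'"
        then have "disjnt C C'"
          using dis by blast
        moreover have "z C \<in> C" "z C' \<in> C'"
          using C z by blast+
        ultimately show False
          using C(3) unfolding disjnt_iff by simp
      qed
      then have "card (z ` (\<F> - {B})) = k"
        using \<F> B unfolding full_def by (simp add: card_image)
      moreover have "y \<notin> z ` (\<F> - {B})" "y' \<notin> z ` (\<F> - {B})"
      proof -
        have "z C \<notin> B" if "C \<in> \<F> - {B}" for C
          using that z dis[of C B] B unfolding disjnt_iff by blast
        moreover have "y \<in> B" "y' \<in> B"
          using y(1,2) unfolding P_eq by blast+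
        ultimately show "y \<notin> z ` (\<F> - {B})" "y' \<notin> z ` (\<F> - {B})"
          by blast+
      qed
      moreover have "finite (z ` (\<F> - {B}))"
        using \<F> unfolding full_def by blast
      ultimately have "card (insert y (insert y' (z ` (\<F> - {B})))) = Suc (Suc k)"
        using y(4) by simp
      moreover have "insert y (insert y' (z ` (\<F> - {B}))) \<subseteq> {v \<in> F. \<phi> v = \<phi> y}"
      proof -
        have "z C \<in> F \<and> \<phi> (z C) = \<phi> y" if "C \<in> \<F>" for C
          using that z \<B> \<F> unfolding full_def by blast
        then show ?thesis
          using y(1-3) PF by auto
      qed
      moreover have "y \<in> F" using y PF by blast
      ultimately show False
        using Suc.prems(3)[of y] card_mono[of "{v \<in> F. \<phi> v = \<phi> y}" "insert y (insert y' (z ` (\<F> - {B})))"]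
        by simp
    qed
    moreover have "mC_on m W (\<phi> ` P)"
      using mC img[OF P PF] closedin_subset by (intro mC_on_closed_subset[OF mC]) auto
    moreover have "continuous_map (subtopology Z P) W \<phi>"
      using \<phi> PF continuous_map_from_subtopology_mono by blast
    ultimately have "mC_on m Z P"
      using mC_on_injective_preimage[OF Z W P] by blast
    then show ?thesis
      using PF unfolding P_def by blast
  qed
  have "mC_on m Z (\<Union>\<E>)"
    using piece_mC unfolding \<E>_def by (intro mC_on_countable_Union[OF \<open>countable \<E>\<close>[unfolded \<E>_def]]) auto
  moreover have "\<Union>\<E> \<subseteq> F"
    using piece_mC unfolding \<E>_def by auto
  ultimately show ?case
    using cloF
  proof (rule mC_on_addition)
    fix P assume P: "closedin Z P" "P \<subseteq> F - \<Union>\<E>"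
    have cP: "compactin Z P"
      using P F closed_compactin by blast
    show "mC_on m Z P"
    proof (rule Suc.IH[OF cP])
      show "continuous_map (subtopology Z P) W \<phi>"
        using \<phi> P continuous_map_from_subtopology_mono by blast
      fix y assume y: "y \<in> P"
      define A where "A = {y' \<in> F. \<phi> y' = \<phi> y}"
      have A: "finite A" "card A \<le> Suc k" "A \<subseteq> F" "y \<in> A"
      proof -
        have "y \<in> F" using y P(2) by blast
        then show "finite A" "card A \<le> Suc k"
          using Suc.prems(3)[OF \<open>y \<in> F\<close>] unfolding A_def by blast+
        show "A \<subseteq> F" "y \<in> A"
          using \<open>y \<in> F\<close> unfolding A_def by blast+
      qed
      have "card A \<noteq> Suc k"
      proof
        assume cA: "card A = Suc k"
        obtain b where b: "\<forall>y\<in>A. b y \<in> \<B> \<and> y \<in> b y"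
          "\<forall>y\<in>A. \<forall>y'\<in>A. y \<noteq> y' \<longrightarrow> disjnt (b y) (b y')"
          using sep[rule_format, OF conjI[OF A(1,3)]] by (elim exE conjE) (rule that)
        have "inj_on b A"
        proof (rule inj_onI, rule ccontr)
          fix y y' assume y: "y \<in> A" "y' \<in> A" "b y = b y'" "y \<noteq> y'"
          have "y \<in> b y"
            using b(1) y(1) by blast
          moreover have "disjnt (b y) (b y')"
            using b(2) y(1,2,4) by blast
          ultimately show False
            using y(3) unfolding disjnt_iff by auto
        qed
        then have "card (b ` A) = Suc k"
          using cA by (simp add: card_image)
        moreover have "pairwise disjnt (b ` A)"
          using b(2) by (auto simp: pairwise_image pairwise_def)
        ultimately have "full (b ` A)"
          unfolding full_def using A(1) b(1) by auto
        moreover have "y \<in> piece (b ` A, b y)"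
        proof -
          have "\<phi> y \<in> \<phi> ` b a" if "a \<in> A" for a
          proof -
            have "\<phi> a = \<phi> y" "a \<in> b a"
              using that b(1) unfolding A_def by auto
            then show ?thesis by (metis imageI)
          qed
          then show ?thesis
            unfolding piece_def using A(4) b(1) by simp
        qed
        ultimately have "y \<in> \<Union>\<E>"
          using A(4) unfolding \<E>_def by blast
        then show False
          using y P by blast
      qed
      moreover have "{y' \<in> P. \<phi> y' = \<phi> y} \<subseteq> A"
        using P unfolding A_def by blast
      ultimately show "finite {y' \<in> P. \<phi> y' = \<phi> y} \<and> card {y' \<in> P. \<phi> y' = \<phi> y} \<le> k"
        using A(1,2) card_mono[of A "{y' \<in> P. \<phi> y' = \<phi> y}"]
          finite_subset[of "{y' \<in> P. \<phi> y' = \<phi> y}" A] by linarith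
    qed
  qed
qed

section \<open>Weakly infinite-dimensional spaces as the case of two-element covers\<close>

text \<open>
The complements of the members of a two-element open cover are disjoint closed sets. The two open
sets that make up the complement of a partition between them form a disjoint refinement.
\<close>

lemma weakly_infinite_dimensional_imp_mC_space_2:
  assumes "weakly_infinite_dimensional Z"
  shows "mC_space 2 Z"
proof (cases "topspace Z = {}")
  case True
  then have "mC_on 2 Z (topspace Z)"
    using mC_on_countable_Union[of "{}" 2 Z] by simp
  then show ?thesis
    using assms unfolding weakly_infinite_dimensional_def mC_space_iff_mC_on by blast
next
  case False
  have "mC_on 2 Z (topspace Z)"
  proof (rule mC_onI)
    fix G :: "nat \<Rightarrow> 'a set set" assume G: "\<And>i. small_open_cover 2 Z (topspace Z) (G i)"
    have "\<exists>U V. U \<in> G i \<and> V \<in> G i \<and> G i = {U, V}" for i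
    proof -
      have "card (G i) \<noteq> 0"
        using G[of i] False unfolding small_open_cover_def by auto
      moreover have "card (G i) \<le> 2"
        using G[of i] unfolding small_open_cover_def by blast
      ultimately have "card (G i) = 1 \<or> card (G i) = 2"
        by linarith
      then obtain U V where "G i = {U, V}"
        by (metis card_1_singletonE card_2_iff insert_absorb2)
      then show ?thesis
        by blast
    qed
    then obtain U V where UV: "\<And>i. U i \<in> G i" "\<And>i. V i \<in> G i" "\<And>i. G i = {U i, V i}"
      by metis
    have op: "openin Z (U i)" "openin Z (V i)" "topspace Z \<subseteq> U i \<union> V i" for i
      using G[of i] UV(3)[of i] unfolding small_open_cover_def by auto
    have "closedin Z (topspace Z - U i) \<and> closedin Z (topspace Z - V i) \<and>
        disjnt (topspace Z - U i) (topspace Z - V i)" for i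
      using op[of i] by (auto simp: disjnt_iff)
    then have "\<exists>L. (\<forall>i. partition_between Z (L i) (topspace Z - U i) (topspace Z - V i)) \<and>
        (\<Inter>i. L i) = {}"
      using assms unfolding weakly_infinite_dimensional_def by simp
    then obtain L where part: "\<forall>i. partition_between Z (L i) (topspace Z - U i) (topspace Z - V i)"
        and L: "(\<Inter>i. L i) = {}"
      by (elim exE conjE) (rule that)
    have "\<exists>P Q. openin Z P \<and> openin Z Q \<and> disjnt P Q \<and> P \<subseteq> V i \<and> Q \<subseteq> U i \<and> topspace Z - L i = P \<union> Q" for i
    proof -
      obtain P Q where PQ: "openin Z P" "openin Z Q" "disjnt P Q" "topspace Z - U i \<subseteq> P"
          "topspace Z - V i \<subseteq> Q" "topspace Z - L i = P \<union> Q"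
        using part[rule_format, of i] unfolding partition_between_def by (elim exE conjE) (rule that)
      then have "P \<subseteq> topspace Z" "Q \<subseteq> topspace Z"
        using openin_subset by blast+
      then have "P \<subseteq> V i \<and> Q \<subseteq> U i"
        using PQ unfolding disjnt_iff by blast
      then show ?thesis
        using PQ by blast
    qed
    then obtain P Q where PQ0: "\<And>i. openin Z (P i) \<and> openin Z (Q i) \<and> disjnt (P i) (Q i) \<and>
        P i \<subseteq> V i \<and> Q i \<subseteq> U i \<and> topspace Z - L i = P i \<union> Q i"
      by metis
    have PQ: "\<And>i. openin Z (P i)" "\<And>i. openin Z (Q i)" "\<And>i. disjnt (P i) (Q i)"
       "\<And>i. P i \<subseteq> V i" "\<And>i. Q i \<subseteq> U i" "\<And>i. topspace Z - L i = P i \<union> Q i"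
      using PQ0 by blast+
    have ref: "disjoint_refinement Z {P i, Q i} (G i)" for i
      unfolding disjoint_refinement_def
    proof (intro conjI)
      show "\<forall>U\<in>{P i, Q i}. openin Z U"
        using PQ(1,2) by simp
      show "pairwise disjnt {P i, Q i}"
        using PQ(3) disjnt_sym[OF PQ(3)] by (simp add: pairwise_insert)
      show "\<forall>U\<in>{P i, Q i}. \<exists>V\<in>G i. U \<subseteq> V"
        using PQ(4,5) UV(1,2) by blast
    qed
    have cover: "topspace Z \<subseteq> \<Union>(\<Union>i. {P i, Q i})"
    proof
      fix z assume z: "z \<in> topspace Z"
      obtain i where "z \<notin> L i"
        using L by auto
      then have "z \<in> P i \<union> Q i"
        using PQ(6)[of i] z by auto
      then show "z \<in> \<Union>(\<Union>i. {P i, Q i})"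
        by auto
    qed
    show "\<exists>H. (\<forall>i. disjoint_refinement Z (H i) (G i)) \<and> topspace Z \<subseteq> \<Union>(\<Union>i. H i)"
      using ref cover by (intro exI[of _ "\<lambda>i. {P i, Q i}"]) simp
  qed
  then show ?thesis
    using assms unfolding weakly_infinite_dimensional_def mC_space_iff_mC_on by blast
qed

text \<open>
A disjoint family of open sets refining the cover by the complements of \<open>A\<close> and \<open>B\<close> splits into
two disjoint open sets, one missing \<open>A\<close> and the other missing \<open>B\<close>, but these need not contain
\<open>B\<close> and \<open>A\<close>. Therefore \<open>A\<close> and \<open>B\<close> are first thickened, using normality, to open sets
\<open>P\<close> and \<open>Q\<close> with disjoint closures. For the cover by the complements of these closures the
thickened sets can be added to the two halves of the refinement without destroying disjointness.
\<close>

lemma mC_space_2_imp_weakly_infinite_dimensional: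
  assumes "mC_space 2 Z"
  shows "weakly_infinite_dimensional Z"
  unfolding weakly_infinite_dimensional_def
proof (intro conjI allI impI)
  show normal: "normal_space Z"
    using assms unfolding mC_space_def by blast
  fix A B :: "nat \<Rightarrow> 'a set"
  assume AB: "\<forall>i. closedin Z (A i) \<and> closedin Z (B i) \<and> disjnt (A i) (B i)"
  have "\<exists>P Q. openin Z P \<and> openin Z Q \<and> A i \<subseteq> P \<and> B i \<subseteq> Q \<and>
      disjnt (Z closure_of P) (Z closure_of Q)" for i
    using AB normal unfolding normal_space_disjoint_closures by blast
  then obtain P Q where PQ0: "\<And>i. openin Z (P i) \<and> openin Z (Q i) \<and> A i \<subseteq> P i \<and> B i \<subseteq> Q i \<and>
      disjnt (Z closure_of P i) (Z closure_of Q i)"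
    by metis
  have PQ: "\<And>i. openin Z (P i)" "\<And>i. openin Z (Q i)" "\<And>i. A i \<subseteq> P i"
      "\<And>i. B i \<subseteq> Q i" "\<And>i. disjnt (Z closure_of P i) (Z closure_of Q i)"
    using PQ0 by blast+
  define U where "U i = topspace Z - Z closure_of P i" for i
  define V where "V i = topspace Z - Z closure_of Q i" for i
  have "small_open_cover 2 Z (topspace Z) {U i, V i}" for i
    using PQ(5)[of i] unfolding small_open_cover_def U_def V_def disjnt_iff
    by (auto simp: card_insert_if)
  moreover have "mC_on 2 Z (topspace Z)"
    using assms unfolding mC_space_iff_mC_on by blast
  ultimately obtain H where H: "\<And>i. disjoint_refinement Z (H i) {U i, V i}"
      and cov: "topspace Z \<subseteq> \<Union>(\<Union>i. H i)"
    using mC_onD[of 2 Z "topspace Z" "\<lambda>i. {U i, V i}"] by auto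
  define S where "S i = P i \<union> \<Union>{W \<in> H i. W \<subseteq> V i}" for i
  define R where "R i = Q i \<union> \<Union>{W \<in> H i. \<not> W \<subseteq> V i}" for i
  have "openin Z (S i)" "openin Z (R i)" for i
    using H[of i] PQ(1,2)[of i] unfolding S_def R_def disjoint_refinement_def by auto
  moreover have "disjnt (S i) (R i)" for i
  proof -
    have inU: "W \<subseteq> U i" if "W \<in> H i" "\<not> W \<subseteq> V i" for W
      using H[of i] that unfolding disjoint_refinement_def by blast
    have dis: "disjnt W W'" if "W \<in> H i" "W' \<in> H i" "W \<noteq> W'" for W W'
      using H[of i] that unfolding disjoint_refinement_def by (meson pairwiseD)
    have "P i \<subseteq> Z closure_of P i" "Q i \<subseteq> Z closure_of Q i"
      using PQ(1,2)[of i] closure_of_subset openin_subset by metis+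
    then have PU: "disjnt (P i) (U i)" "disjnt (Q i) (V i)" "disjnt (P i) (Q i)"
      using PQ(5)[of i] unfolding U_def V_def disjnt_iff by blast+
    have "disjnt W W'" if "W \<in> {W \<in> H i. W \<subseteq> V i}" "W' \<in> {W \<in> H i. \<not> W \<subseteq> V i}" for W W'
      using dis[of W W'] that by auto
    then have "disjnt (\<Union>{W \<in> H i. W \<subseteq> V i}) (\<Union>{W \<in> H i. \<not> W \<subseteq> V i})"
      by simp
    moreover have "disjnt (P i) (\<Union>{W \<in> H i. \<not> W \<subseteq> V i})"
      using inU PU(1) unfolding disjnt_iff by blast
    moreover have "disjnt (\<Union>{W \<in> H i. W \<subseteq> V i}) (Q i)"
      using PU(2) unfolding disjnt_iff by blast
    ultimately show ?thesis
      using PU(3) unfolding S_def R_def disjnt_Un1 disjnt_Un2 by simp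
  qed
  moreover have "A i \<subseteq> S i" "B i \<subseteq> R i" for i
    using PQ(3,4)[of i] unfolding S_def R_def by blast+
  ultimately have part: "partition_between Z (topspace Z - (S i \<union> R i)) (A i) (B i)" for i
  proof -
    have "topspace Z - (topspace Z - (S i \<union> R i)) = S i \<union> R i"
      using \<open>\<And>i. openin Z (S i)\<close>[of i] \<open>\<And>i. openin Z (R i)\<close>[of i] openin_subset by fast
    then show ?thesis
      unfolding partition_between_def
      using \<open>\<And>i. openin Z (S i)\<close>[of i] \<open>\<And>i. openin Z (R i)\<close>[of i] \<open>disjnt (S i) (R i)\<close>
        \<open>A i \<subseteq> S i\<close> \<open>B i \<subseteq> R i\<close> by blast
  qed
  have "(\<Inter>i. topspace Z - (S i \<union> R i)) = {}"
  proof -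
    have "\<exists>i. z \<in> S i \<union> R i" if "z \<in> topspace Z" for z
    proof -
      obtain i W where "W \<in> H i" "z \<in> W"
        using cov \<open>z \<in> topspace Z\<close> by blast
      then have "z \<in> S i \<union> R i"
        unfolding S_def R_def by blast
      then show ?thesis ..
    qed
    then show ?thesis
      by blast
  qed
  then show "\<exists>L. (\<forall>i. partition_between Z (L i) (A i) (B i)) \<and> (\<Inter>i. L i) = {}"
    using part by (intro exI[of _ "\<lambda>i. topspace Z - (S i \<union> R i)"]) simp
qed


section \<open>Function spaces with the topology of pointwise convergence\<close>

lemma finite_interpolation:
  fixes v :: "'a \<Rightarrow> real"
  assumes X: "metrizable_space X" and K: "finite K" "K \<subseteq> topspace X"
    and "a \<le> b" and v: "\<And>x. x \<in> K \<Longrightarrow> v x \<in> {a..b}"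
  shows "\<exists>h. continuous_map X euclideanreal h \<and> (\<forall>x\<in>topspace X. h x \<in> {a..b}) \<and> (\<forall>x\<in>K. h x = v x)"
proof -
  have Haus: "Hausdorff_space X"
    using X by (rule metrizable_imp_Hausdorff_space)
  have "continuous_map (subtopology X K) euclideanreal v"
    unfolding continuous_map_closedin
  proof (intro conjI allI impI)
    fix C assume "closedin euclideanreal C"
    have "{x \<in> topspace (subtopology X K). v x \<in> C} \<subseteq> K"
      by auto
    then show "closedin (subtopology X K) {x \<in> topspace (subtopology X K). v x \<in> C}"
      using K Haus by (meson closedin_Hausdorff_finite closedin_subset_topspace finite_subset subset_trans)
  qed auto
  moreover have "closedin X K"
    using Haus K by (simp add: closedin_Hausdorff_finite)
  ultimately obtain h where "continuous_map X euclideanreal h" "h ` topspace X \<subseteq> {a..b}"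
      "\<And>x. x \<in> K \<Longrightarrow> h x = v x"
    using Tietze_extension_realinterval[of X K "{a..b}" v] metrizable_imp_normal_space[OF X]
      is_interval_cc v \<open>a \<le> b\<close> by (metis atLeastatMost_empty_iff2 image_subsetI not_le)
  then show ?thesis
    by (intro exI[of _ h]) auto
qed

lemma mem_Dp_iff:
  "f \<in> topspace (Dp D X) \<longleftrightarrow> f \<in> extensional (topspace X) \<and> in_class D X f"
  unfolding Dp_def by (auto simp: PiE_def)

lemma in_class_imp_continuous: "in_class D X f \<Longrightarrow> continuous_map X euclideanreal f"
  by (cases D) auto

lemma bounded_fun_on_iff: "bounded_fun_on X f \<longleftrightarrow> (\<exists>B. \<forall>x\<in>topspace X. \<bar>f x\<bar> \<le> B)"
  unfolding bounded_fun_on_def bounded_iff by auto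

text \<open>
Pointwise convex combinations with continuous weights stay in either of the two classes of
functions. All modifications of functions below have this form.
\<close>

lemma interpolated_in_Dp:
  assumes f: "f \<in> topspace (Dp D X)" and g: "g \<in> topspace (Dp D X)"
    and \<theta>: "continuous_map X euclideanreal \<theta>" "\<And>x. x \<in> topspace X \<Longrightarrow> \<theta> x \<in> {0..1}"
  shows "(\<lambda>x\<in>topspace X. f x + \<theta> x * (g x - f x)) \<in> topspace (Dp D X)"
proof -
  have fg: "continuous_map X euclideanreal f" "continuous_map X euclideanreal g"
    using f g in_class_imp_continuous unfolding mem_Dp_iff by auto
  have "continuous_map X euclideanreal (\<lambda>x. f x + \<theta> x * (g x - f x))"
    by (intro continuous_intros fg \<theta>(1))
  then have cont: "continuous_map X euclideanreal (\<lambda>x\<in>topspace X. f x + \<theta> x * (g x - f x))"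
    by (rule continuous_map_eq) simp
  have "bounded_fun_on X (\<lambda>x\<in>topspace X. f x + \<theta> x * (g x - f x))"
    if bd: "bounded_fun_on X f" "bounded_fun_on X g"
  proof -
    obtain a b where ab: "\<forall>x\<in>topspace X. \<bar>f x\<bar> \<le> a" "\<forall>x\<in>topspace X. \<bar>g x\<bar> \<le> b"
      using bd unfolding bounded_fun_on_iff by (elim exE) (rule that)
    have "\<bar>f x + \<theta> x * (g x - f x)\<bar> \<le> a + (a + b)" if x: "x \<in> topspace X" for x
    proof -
      have "\<bar>\<theta> x * (g x - f x)\<bar> = \<theta> x * \<bar>g x - f x\<bar>"
        using \<theta>(2)[OF x] by (simp add: abs_mult)
      also have "\<dots> \<le> \<bar>g x - f x\<bar>"
        using \<theta>(2)[OF x] by (simp add: mult_left_le_one_le)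
      finally have "\<bar>\<theta> x * (g x - f x)\<bar> \<le> \<bar>g x - f x\<bar>" .
      moreover have "\<bar>f x\<bar> \<le> a" "\<bar>g x\<bar> \<le> b"
        using ab x by auto
      ultimately show ?thesis by linarith
    qed
    then show ?thesis
      unfolding bounded_fun_on_iff by auto
  qed
  then show ?thesis
    using f g cont unfolding mem_Dp_iff by (cases D) auto
qed

lemma diff_fun_in_Dp:
  assumes f: "f \<in> topspace (Dp D X)" and g: "g \<in> topspace (Dp D X)"
  shows "diff_fun X f g \<in> topspace (Dp D X)"
proof -
  have fg: "continuous_map X euclideanreal f" "continuous_map X euclideanreal g"
    using f g in_class_imp_continuous unfolding mem_Dp_iff by auto
  have "continuous_map X euclideanreal (\<lambda>x. f x - g x)"
    by (intro continuous_intros fg)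
  then have cont: "continuous_map X euclideanreal (diff_fun X f g)"
    unfolding diff_fun_def by (rule continuous_map_eq) simp
  have "bounded_fun_on X (diff_fun X f g)" if bd: "bounded_fun_on X f" "bounded_fun_on X g"
  proof -
    obtain a b where ab: "\<forall>x\<in>topspace X. \<bar>f x\<bar> \<le> a" "\<forall>x\<in>topspace X. \<bar>g x\<bar> \<le> b"
      using bd unfolding bounded_fun_on_iff by (elim exE) (rule that)
    have "\<bar>f x - g x\<bar> \<le> a + b" if "x \<in> topspace X" for x
      using ab that by (smt (verit))
    then show ?thesis
      unfolding bounded_fun_on_iff diff_fun_def by auto
  qed
  then show ?thesis
    using f g cont unfolding mem_Dp_iff by (cases D) (auto simp: diff_fun_def)
qed

lemma zero_neighbourhood_Dp:
  assumes "neighbourhood_in (Dp D X) (zero_fun X) V"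
  shows "\<exists>K \<epsilon>. finite K \<and> K \<subseteq> topspace X \<and> \<epsilon> > 0 \<and>
           (\<forall>h\<in>topspace (Dp D X). (\<forall>x\<in>K. \<bar>h x\<bar> < \<epsilon>) \<longrightarrow> h \<in> V)"
proof -
  obtain W where W: "openin (Dp D X) W" "zero_fun X \<in> W" "W \<subseteq> V"
    using assms unfolding neighbourhood_in_def by auto
  then obtain W' where W': "openin (product_topology (\<lambda>_. euclideanreal) (topspace X)) W'"
      "W = W' \<inter> {f. in_class D X f}"
    unfolding Dp_def openin_subtopology by auto
  have "zero_fun X \<in> W'"
    using W(2) W'(2) by simp
  with W'(1) have "\<exists>U. finite {x \<in> topspace X. U x \<noteq> (UNIV :: real set)} \<and>
      (\<forall>x\<in>topspace X. open (U x)) \<and> zero_fun X \<in> Pi\<^sub>E (topspace X) U \<and> Pi\<^sub>E (topspace X) U \<subseteq> W'"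
    unfolding openin_product_topology_alt by simp
  then obtain U where U: "finite {x \<in> topspace X. U x \<noteq> (UNIV :: real set)}"
      "\<forall>x\<in>topspace X. open (U x)" "zero_fun X \<in> Pi\<^sub>E (topspace X) U" "Pi\<^sub>E (topspace X) U \<subseteq> W'"
    by (elim exE conjE) (rule that)
  define K where "K = {x \<in> topspace X. U x \<noteq> UNIV}"
  have "\<exists>e>0. \<forall>t. \<bar>t\<bar> < e \<longrightarrow> t \<in> U x" if "x \<in> K" for x
  proof -
    have "x \<in> topspace X"
      using that unfolding K_def by simp
    then have "open (U x)" "0 \<in> U x"
      using U(2,3) by (auto simp: zero_fun_def PiE_iff)
    then have "\<exists>e>0. \<forall>t. dist t 0 < e \<longrightarrow> t \<in> U x"
      unfolding open_dist by blast
    then show ?thesis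
      by (simp add: dist_real_def)
  qed
  then obtain e where e: "\<And>x. x \<in> K \<Longrightarrow> e x > 0 \<and> (\<forall>t. \<bar>t\<bar> < e x \<longrightarrow> t \<in> U x)"
    by metis
  have fin: "finite (insert 1 (e ` K))"
    using U(1) unfolding K_def by simp
  define \<epsilon> where "\<epsilon> = Min (insert 1 (e ` K))"
  have "\<epsilon> > 0"
    unfolding \<epsilon>_def using fin e by (subst Min_gr_iff) auto
  moreover have "h \<in> V" if h: "h \<in> topspace (Dp D X)" "\<forall>x\<in>K. \<bar>h x\<bar> < \<epsilon>" for h
  proof -
    have "h x \<in> U x" if "x \<in> topspace X" for x
    proof (cases "x \<in> K")
      case True
      then have "\<epsilon> \<le> e x"
        unfolding \<epsilon>_def using fin by (intro Min_le) auto
      then show ?thesis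
        using True h(2) e by fastforce
    next
      case False
      then show ?thesis
        using that unfolding K_def by simp
    qed
    then have "h \<in> Pi\<^sub>E (topspace X) U"
      using h(1) unfolding mem_Dp_iff by (simp add: PiE_iff)
    then have "h \<in> W'"
      using U(4) by blast
    then show ?thesis
      using W(3) W'(2) h(1) unfolding mem_Dp_iff by auto
  qed
  moreover have "finite K" "K \<subseteq> topspace X"
    using U(1) unfolding K_def by auto
  ultimately show ?thesis
    by (intro exI[of _ K] exI[of _ \<epsilon>]) simp
qed

lemma point_neighbourhood_Dp:
  assumes "y \<in> topspace Y"
  shows "neighbourhood_in (Dp D Y) (zero_fun Y) {h \<in> topspace (Dp D Y). \<bar>h y\<bar> < 1}"
proof -
  let ?P = "product_topology (\<lambda>_. euclideanreal) (topspace Y)"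
  have "continuous_map (Dp D Y) euclideanreal (\<lambda>h. h y)"
    unfolding Dp_def using assms
    by (intro continuous_map_from_subtopology continuous_map_product_projection)
  then have "openin (Dp D Y) {h \<in> topspace (Dp D Y). h y \<in> {-1<..<1}}"
    by (rule openin_continuous_map_preimage) simp
  moreover have "{h \<in> topspace (Dp D Y). h y \<in> {-1<..<1}} = {h \<in> topspace (Dp D Y). \<bar>h y\<bar> < 1}"
    by auto
  moreover have "zero_fun Y \<in> topspace (Dp D Y)"
  proof -
    have "continuous_map Y euclideanreal (zero_fun Y)"
      unfolding zero_fun_def by (rule continuous_map_eq[of _ _ "\<lambda>_. 0"]) auto
    moreover have "bounded_fun_on Y (zero_fun Y)"
      unfolding bounded_fun_on_iff zero_fun_def by auto
    ultimately show ?thesis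
      unfolding mem_Dp_iff by (cases D) (auto simp: zero_fun_def)
  qed
  ultimately show ?thesis
    unfolding neighbourhood_in_def using assms
    by (intro conjI exI[of _ "{h \<in> topspace (Dp D Y). \<bar>h y\<bar> < 1}"]) (auto simp: zero_fun_def)
qed

section \<open>Finite sets controlling the values of the image functions\<close>

locale good_surjection =
  fixes X :: "'a topology" and Y :: "'b topology" and D :: fun_class
    and T :: "('a \<Rightarrow> real) \<Rightarrow> ('b \<Rightarrow> real)" and c :: real
  assumes metX: "metrizable_space X" and metY: "metrizable_space Y"
    and surj: "T ` topspace (Dp D X) = topspace (Dp D Y)"
    and unif: "uniformly_continuous_Dp D X Y T"
    and c_pos: "c > 0" and good: "c_good D X Y c T"
begin

text \<open>
A nonlinear substitute for the support of the functional that sends \<open>f\<close> to \<open>T f y\<close>: if \<open>T\<close> is linear,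
a bound \<open>p\<close> as below exists for a finite set exactly if the set contains this support. The
strict inequality makes the condition open in the points of \<open>K\<close>.
\<close>

definition controls :: "real \<Rightarrow> 'b \<Rightarrow> 'a set \<Rightarrow> bool" where
  "controls p y K \<longleftrightarrow>
     (\<forall>f\<in>topspace (Dp D X). \<forall>g\<in>topspace (Dp D X).
        (\<forall>x\<in>K. \<bar>f x - g x\<bar> < 1) \<longrightarrow> \<bar>T f y - T g y\<bar> \<le> p)"

lemma controlsD:
  "controls p y K \<Longrightarrow> f \<in> topspace (Dp D X) \<Longrightarrow> g \<in> topspace (Dp D X) \<Longrightarrow>
     (\<And>x. x \<in> K \<Longrightarrow> \<bar>f x - g x\<bar> < 1) \<Longrightarrow> \<bar>T f y - T g y\<bar> \<le> p"
  unfolding controls_def by blast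

text \<open>
Uniform continuity at the zero neighbourhood given by \<open>y\<close> yields a finite set \<open>K\<close> and
\<open>\<epsilon> > 0\<close> such that functions closer than \<open>\<epsilon>\<close> on \<open>K\<close> have images closer than 1 at \<open>y\<close>. Functions
closer than 1 on \<open>K\<close> are joined by a segment, cut into \<open>N\<close> steps shorter than \<open>\<epsilon>\<close>, so
their images differ by at most \<open>N\<close>.
\<close>

lemma exists_controls:
  assumes y: "y \<in> topspace Y"
  shows "\<exists>(N::nat) K. finite K \<and> K \<subseteq> topspace X \<and> controls (real N) y K"
proof -
  obtain V where V: "neighbourhood_in (Dp D X) (zero_fun X) V"
    "\<forall>f \<in> topspace (Dp D X). \<forall>g \<in> topspace (Dp D X).
        diff_fun X f g \<in> V \<longrightarrow> diff_fun Y (T f) (T g) \<in> {h \<in> topspace (Dp D Y). \<bar>h y\<bar> < 1}"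
    using unif[unfolded uniformly_continuous_Dp_def, rule_format, OF point_neighbourhood_Dp[OF y, of D]]
    by (elim exE conjE) (rule that)
  obtain K \<epsilon> where K: "finite K" "K \<subseteq> topspace X" "\<epsilon> > 0"
    "\<forall>h\<in>topspace (Dp D X). (\<forall>x\<in>K. \<bar>h x\<bar> < \<epsilon>) \<longrightarrow> h \<in> V"
    using zero_neighbourhood_Dp[OF V(1)] by (elim exE conjE) (rule that)
  have close: "\<bar>T f y - T g y\<bar> < 1"
    if "f \<in> topspace (Dp D X)" "g \<in> topspace (Dp D X)" "\<And>x. x \<in> K \<Longrightarrow> \<bar>f x - g x\<bar> < \<epsilon>" for f g
  proof -
    have "\<forall>x\<in>K. \<bar>diff_fun X f g x\<bar> < \<epsilon>"
      using that(3) K(2) unfolding diff_fun_def by auto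
    then have "diff_fun X f g \<in> V"
      using K(4) diff_fun_in_Dp[OF that(1,2)] by simp
    then have "\<bar>diff_fun Y (T f) (T g) y\<bar> < 1"
      using V(2) that(1,2) by simp
    then show ?thesis
      using y unfolding diff_fun_def by simp
  qed
  obtain n where n: "1 / Suc n < \<epsilon>"
    using nat_approx_posE[OF K(3)] by metis
  define N where "N = Suc n"
  have "controls (real N) y K"
    unfolding controls_def
  proof (intro ballI impI)
    fix f g assume f: "f \<in> topspace (Dp D X)" and g: "g \<in> topspace (Dp D X)"
      and fg: "\<forall>x\<in>K. \<bar>f x - g x\<bar> < 1"
    define F where "F i = (\<lambda>x\<in>topspace X. f x + (real i / N) * (g x - f x))" for i :: nat
    have F_in: "F i \<in> topspace (Dp D X)" if "i \<le> N" for i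
      unfolding F_def using that f g
      by (intro interpolated_in_Dp) (auto simp: N_def divide_le_eq)
    have step: "\<bar>T (F i) y - T (F (Suc i)) y\<bar> < 1" if "Suc i \<le> N" for i
    proof (rule close)
      fix x assume x: "x \<in> K"
      have "F i x - F (Suc i) x = (f x - g x) / N"
      proof -
        have "x \<in> topspace X" using x K(2) by blast
        then have "F i x - F (Suc i) x = (real i / N - real (Suc i) / N) * (g x - f x)"
          unfolding F_def by (simp add: left_diff_distrib)
        also have "real i / N - real (Suc i) / N = - 1 / N"
          by (simp add: diff_divide_distrib[symmetric])
        finally show ?thesis
          by (simp add: diff_divide_distrib algebra_simps)
      qed
      then have "\<bar>F i x - F (Suc i) x\<bar> = \<bar>f x - g x\<bar> / N"
        by simp
      also have "\<dots> \<le> 1 / N"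
        using fg x by (intro divide_right_mono) (auto intro: less_imp_le)
      finally show "\<bar>F i x - F (Suc i) x\<bar> < \<epsilon>"
        using n unfolding N_def by linarith
    qed (use F_in that in auto)
    have "\<bar>T (F 0) y - T (F i) y\<bar> \<le> real i" if "i \<le> N" for i
      using that
    proof (induction i)
      case (Suc i)
      then show ?case
        using step[of i] by simp
    qed simp
    then have "\<bar>T (F 0) y - T (F N) y\<bar> \<le> real N"
      by simp
    moreover have "F 0 = f" "F N = g"
      using f g unfolding F_def mem_Dp_iff N_def by (auto simp: extensional_def fun_eq_iff)
    ultimately show "\<bar>T f y - T g y\<bar> \<le> real N"
      by simp
  qed
  then show ?thesis
    using K(1,2) by (intro exI[of _ N] exI[of _ K]) simp
qed

text \<open>
If \<open>f\<close> and \<open>g\<close> are close on \<open>K \<inter> L\<close>, a function \<open>h\<close> that equals \<open>g\<close> on \<open>L\<close> and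
\<open>f\<close> on the rest of \<open>K\<close> is close to \<open>f\<close> on \<open>K\<close> and to \<open>g\<close> on \<open>L\<close>.
\<close>

lemma controls_Int:
  assumes K: "finite K" "K \<subseteq> topspace X" and L: "finite L" "L \<subseteq> topspace X"
    and p: "controls p y K" and q: "controls q y L"
  shows "controls (p + q) y (K \<inter> L)"
  unfolding controls_def
proof (intro ballI impI)
  fix f g assume f: "f \<in> topspace (Dp D X)" and g: "g \<in> topspace (Dp D X)"
    and fg: "\<forall>x\<in>K \<inter> L. \<bar>f x - g x\<bar> < 1"
  have "\<exists>\<theta>. continuous_map X euclideanreal \<theta> \<and> (\<forall>x\<in>topspace X. \<theta> x \<in> {0..1}) \<and>
     (\<forall>x\<in>K \<union> L. \<theta> x = (if x \<in> L then 1 else 0))"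
    by (rule finite_interpolation[OF metX]) (use K L in auto)
  then obtain \<theta> where \<theta>: "continuous_map X euclideanreal \<theta>" "\<forall>x\<in>topspace X. \<theta> x \<in> {0..1}"
     "\<forall>x\<in>K \<union> L. \<theta> x = (if x \<in> L then 1 else 0)"
    by (elim exE conjE) (rule that)
  define h where "h = (\<lambda>x\<in>topspace X. f x + \<theta> x * (g x - f x))"
  have h: "h \<in> topspace (Dp D X)"
    unfolding h_def using f g \<theta>(1,2) by (intro interpolated_in_Dp) auto
  have hL: "h x = g x" if "x \<in> L" for x
    using that L(2) \<theta>(3) unfolding h_def by auto
  have hK: "h x = f x" if "x \<in> K - L" for x
    using that K(2) \<theta>(3) unfolding h_def by auto
  have "\<bar>T f y - T h y\<bar> \<le> p"
  proof (rule controlsD[OF p f h])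
    fix x assume "x \<in> K"
    then show "\<bar>f x - h x\<bar> < 1"
      using hL[of x] hK[of x] fg by (cases "x \<in> L") auto
  qed
  moreover have "\<bar>T h y - T g y\<bar> \<le> q"
    by (rule controlsD[OF q h g]) (simp add: hL)
  ultimately show "\<bar>T f y - T g y\<bar> \<le> p + q"
    by linarith
qed

lemma continuous_Dp_image:
  assumes "f \<in> topspace (Dp D X)"
  shows "continuous_map Y euclideanreal (T f)"
proof -
  have "T f \<in> topspace (Dp D Y)"
    using assms surj by blast
  then show ?thesis
    unfolding mem_Dp_iff using in_class_imp_continuous by blast
qed

text \<open>
Controls are represented by tuples, so that sets of at most \<open>q\<close> points form a space. A tuple fails
to control \<open>y\<close> because of some pair \<open>f\<close>, \<open>g\<close>, and the same pair works for all nearby points and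
tuples, as \<open>f\<close>, \<open>g\<close>, \<open>T f\<close> and \<open>T g\<close> are continuous.
\<close>

lemma closedin_controls:
  "closedin (prod_topology Y (finite_power X q))
     {z \<in> topspace (prod_topology Y (finite_power X q)). controls p (fst z) (snd z ` {..<q})}"
    (is "closedin ?Z ?S")
proof -
  define O1 where "O1 f g = {z \<in> topspace ?Z. p < \<bar>T f (fst z) - T g (fst z)\<bar>} \<inter>
      ((\<Inter>j\<in>{..<q}. {z \<in> topspace ?Z. \<bar>f (snd z j) - g (snd z j)\<bar> < 1}) \<inter> topspace ?Z)" for f g
  have "openin ?Z (O1 f g)" if f: "f \<in> topspace (Dp D X)" and g: "g \<in> topspace (Dp D X)" for f g
    unfolding O1_def
  proof (rule openin_Int, goal_cases)
    case 1
    have "continuous_map ?Z euclideanreal (\<lambda>z. \<bar>T f (fst z) - T g (fst z)\<bar>)"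
      by (intro continuous_map_real_abs continuous_map_diff
            continuous_map_compose[OF continuous_map_fst continuous_Dp_image, unfolded o_def] f g)
    from openin_continuous_map_preimage[OF this, of "{p<..}"]
    show ?case
      by simp
  next
    case 2
    show ?case
    proof (rule openin_INT)
      fix j assume j: "j \<in> {..<q}"
      have proj: "continuous_map ?Z X (\<lambda>z. snd z j)"
        using continuous_map_compose[OF continuous_map_snd, of "finite_power X q" X "\<lambda>x. x j"]
          continuous_map_product_projection[OF j, of "\<lambda>_. X"] unfolding finite_power_def o_def by blast
      have cont: "continuous_map X euclideanreal f" "continuous_map X euclideanreal g"
        using f g in_class_imp_continuous unfolding mem_Dp_iff by auto
      have "continuous_map ?Z euclideanreal (\<lambda>z. \<bar>f (snd z j) - g (snd z j)\<bar>)"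
        by (intro continuous_map_real_abs continuous_map_diff
              continuous_map_compose[OF proj cont(1), unfolded o_def]
              continuous_map_compose[OF proj cont(2), unfolded o_def])
      from openin_continuous_map_preimage[OF this, of "{..<1}"]
      show "openin ?Z {z \<in> topspace ?Z. \<bar>f (snd z j) - g (snd z j)\<bar> < 1}"
        by simp
    qed simp
  qed
  then have "openin ?Z (\<Union>f\<in>topspace (Dp D X). \<Union>g\<in>topspace (Dp D X). O1 f g)"
    by (intro openin_Union) auto
  moreover have "topspace ?Z - ?S = (\<Union>f\<in>topspace (Dp D X). \<Union>g\<in>topspace (Dp D X). O1 f g)"
  proof -
    have "z \<in> O1 f g \<longleftrightarrow> z \<in> topspace ?Z \<and> \<not> \<bar>T f (fst z) - T g (fst z)\<bar> \<le> p \<and>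
        (\<forall>x\<in>snd z ` {..<q}. \<bar>f x - g x\<bar> < 1)" for z f g
      unfolding O1_def by (auto simp: not_le simp del: topspace_prod_topology)
    then show ?thesis
      unfolding controls_def by blast
  qed
  ultimately show ?thesis
    unfolding closedin_def by simp
qed

text \<open>
This is where \<open>c\<close>-goodness enters. Suppose that \<open>K\<close> controls all points of a finite set \<open>S\<close>.
For each of the \<open>2 ^ card S\<close> sign patterns on \<open>S\<close> there is a function with values \<open>R\<close> and
\<open>- R\<close> on \<open>S\<close> according to the pattern, and it is the image of a function bounded by \<open>c * R\<close>. If
\<open>2 * R > p\<close>, the functions for two different patterns differ by at least 1 at some point of
\<open>K\<close>. But on \<open>K\<close> there is room for only boundedly many functions with this property, since they are
told apart by the integer parts of their values.
\<close>

lemma controlled_points_bounded: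
  "\<exists>k. \<forall>K. finite K \<and> K \<subseteq> topspace X \<and> card K \<le> q \<longrightarrow>
     finite {y \<in> topspace Y. controls p y K} \<and> card {y \<in> topspace Y. controls p y K} \<le> k"
proof -
  define R where "R = \<bar>p\<bar> + 1"
  define N where "N = \<lceil>c * R\<rceil>"
  define k where "k = card {- N - 1..N} ^ q"
  have "N \<ge> 0"
    unfolding N_def R_def using c_pos by (simp add: ceiling_le_zero order_less_le_trans[of "-1::real" 0])
  have bound: "finite S \<and> card S \<le> k" if K: "finite K" "K \<subseteq> topspace X" "card K \<le> q"
      and S: "S \<subseteq> {y \<in> topspace Y. controls p y K}" "finite S" for S K
  proof -
    have "\<exists>f\<in>topspace (Dp D X). (\<forall>x\<in>topspace X. \<bar>f x\<bar> \<le> c * R) \<and>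
        (\<forall>y\<in>S. T f y = (if y \<in> A then R else - R))" for A
    proof -
      have "\<exists>g0. continuous_map Y euclideanreal g0 \<and> (\<forall>y\<in>topspace Y. g0 y \<in> {- R..R}) \<and>
          (\<forall>y\<in>S. g0 y = (if y \<in> A then R else - R))"
        by (rule finite_interpolation[OF metY]) (use S in \<open>auto simp: R_def\<close>)
      then obtain g0 where g0: "continuous_map Y euclideanreal g0" "\<forall>y\<in>topspace Y. g0 y \<in> {- R..R}"
          "\<forall>y\<in>S. g0 y = (if y \<in> A then R else - R)"
        by (elim exE conjE) (rule that)
      define g where "g = restrict g0 (topspace Y)"
      have "continuous_map Y euclideanreal g"
        unfolding g_def by (rule continuous_map_eq[OF g0(1)]) simp
      moreover have bg: "\<bar>g y\<bar> \<le> R" if "y \<in> topspace Y" for y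
        using g0(2) that unfolding g_def by (auto simp: abs_le_iff)
      then have bdg: "bounded_fun_on Y g"
        unfolding bounded_fun_on_iff by blast
      ultimately have "g \<in> topspace (Dp D Y)"
        unfolding mem_Dp_iff by (cases D) (auto simp: g_def)
      then obtain f where f: "f \<in> topspace (Dp D X)" "bounded_fun_on X f" "T f = g"
          "sup_norm X f \<le> c * sup_norm Y g"
        using good bdg unfolding c_good_def by blast
      have "sup_norm Y g \<le> R"
        unfolding sup_norm_def using bg by (intro cSup_least) (auto simp: R_def)
      then have "sup_norm X f \<le> c * R"
        using f(4) c_pos by (meson mult_left_mono less_imp_le order_trans)
      moreover have "\<bar>f x\<bar> \<le> sup_norm X f" if "x \<in> topspace X" for x
      proof -
        obtain B where "\<forall>x\<in>topspace X. \<bar>f x\<bar> \<le> B"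
          using f(2) unfolding bounded_fun_on_iff by blast
        then have "bdd_above (insert 0 ((\<lambda>x. \<bar>f x\<bar>) ` topspace X))"
          by (auto intro!: bdd_aboveI2)
        then show ?thesis
          unfolding sup_norm_def using that by (intro cSup_upper) auto
      qed
      ultimately have "\<forall>x\<in>topspace X. \<bar>f x\<bar> \<le> c * R"
        by (meson order_trans)
      moreover have "\<forall>y\<in>S. T f y = (if y \<in> A then R else - R)"
        using g0(3) S(1) f(3) unfolding g_def by auto
      ultimately show ?thesis
        using f(1) by blast
    qed
    then obtain F where F: "\<And>A. F A \<in> topspace (Dp D X)" "\<And>A x. x \<in> topspace X \<Longrightarrow> \<bar>F A x\<bar> \<le> c * R"
        "\<And>A y. y \<in> S \<Longrightarrow> T (F A) y = (if y \<in> A then R else - R)"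
      by metis
    define \<Phi> where "\<Phi> A = (\<lambda>x\<in>K. \<lfloor>F A x\<rfloor>)" for A
    have "\<Phi> A \<in> K \<rightarrow>\<^sub>E {- N - 1..N}" for A
    proof -
      have "- N - 1 \<le> \<lfloor>F A x\<rfloor> \<and> \<lfloor>F A x\<rfloor> \<le> N" if "x \<in> K" for x
      proof -
        have "\<bar>F A x\<bar> \<le> c * R"
          using F(2) that K(2) by blast
        then have "\<bar>F A x\<bar> \<le> N"
          unfolding N_def using le_of_int_ceiling order_trans by blast
        then show ?thesis
          by linarith
      qed
      then show ?thesis
        unfolding \<Phi>_def by auto
    qed
    moreover have "inj_on \<Phi> (Pow S)"
    proof (rule inj_onI)
      fix A B assume AB: "A \<in> Pow S" "B \<in> Pow S" "\<Phi> A = \<Phi> B"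
      have near: "\<bar>F A x - F B x\<bar> < 1" if "x \<in> K" for x
      proof -
        have "\<lfloor>F A x\<rfloor> = \<lfloor>F B x\<rfloor>"
          using fun_cong[OF AB(3), of x] that unfolding \<Phi>_def by simp
        then show ?thesis by linarith
      qed
      have "y \<in> A \<longleftrightarrow> y \<in> B" if y: "y \<in> S" for y
      proof -
        have "controls p y K"
          using S(1) y by blast
        then have "\<bar>T (F A) y - T (F B) y\<bar> \<le> p"
          using near by (rule controlsD[OF _ F(1) F(1)])
        then show ?thesis
          using F(3)[OF y, of A] F(3)[OF y, of B] unfolding R_def by (auto split: if_splits)
      qed
      then show "A = B"
        using AB(1,2) by blast
    qed
    ultimately have "card (Pow S) \<le> card (K \<rightarrow>\<^sub>E {- N - 1..N})"
      using K(1) by (intro card_inj_on_le) (auto intro: finite_PiE)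
    also have "\<dots> = card {- N - 1..N} ^ card K"
      using K(1) by (simp add: card_PiE)
    also have "\<dots> \<le> k"
      unfolding k_def using K(3) \<open>N \<ge> 0\<close> by (intro power_increasing) (auto simp: Suc_le_eq card_gt_0_iff)
    finally have "2 ^ card S \<le> k"
      using S(2) by (simp add: card_Pow)
    then have "card S \<le> k"
      using less_exp[of "card S"] by linarith
    then show ?thesis
      using S(2) by blast
  qed
  show ?thesis
  proof (intro exI[of _ k] allI impI)
    fix K assume K: "finite K \<and> K \<subseteq> topspace X \<and> card K \<le> q"
    have "card S \<le> k" if "S \<subseteq> {y \<in> topspace Y. controls p y K}" "finite S" for S
      using bound[OF _ _ _ that] K by blast
    then show "finite {y \<in> topspace Y. controls p y K} \<and> card {y \<in> topspace Y. controls p y K} \<le> k"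
      by (rule finite_if_finite_subsets_card_bdd)
  qed
qed

end


section \<open>Decomposition of the target into compact parametrised pieces\<close>

text \<open>
The projection of a compact relation is a closed map, so where it is injective its inverse is
continuous.
\<close>

lemma compact_graph_selection:
  assumes Y: "Hausdorff_space Y" and W: "Hausdorff_space W"
    and R: "compactin (prod_topology Y W) R" and inj: "inj_on fst R"
  shows "\<exists>s. continuous_map (subtopology Y (fst ` R)) W s \<and> (\<forall>z\<in>R. s (fst z) = snd z)"
proof -
  define s where "s y = snd (inv_into R fst y)" for y
  have s: "s (fst z) = snd z" if "z \<in> R" for z
    unfolding s_def using inj that by simp
  have RZ: "R \<subseteq> topspace (prod_topology Y W)"
    using R compactin_subset_topspace by blast
  have top: "topspace (subtopology Y (fst ` R)) = fst ` R"
    using RZ by (intro topspace_subtopology_subset) auto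
  have "continuous_map (subtopology Y (fst ` R)) W s"
    unfolding continuous_map_closedin
  proof (intro conjI allI impI)
    show "s \<in> topspace (subtopology Y (fst ` R)) \<rightarrow> topspace W"
      unfolding top using s RZ by auto
    fix C assume C: "closedin W C"
    have "closedin (prod_topology Y W) {z \<in> topspace (prod_topology Y W). snd z \<in> C}"
      by (rule closedin_continuous_map_preimage[OF continuous_map_snd C])
    then have "compactin (prod_topology Y W) (R \<inter> {z \<in> topspace (prod_topology Y W). snd z \<in> C})"
      by (rule compact_Int_closedin[OF R])
    then have "compactin Y (fst ` (R \<inter> {z \<in> topspace (prod_topology Y W). snd z \<in> C}))"
      by (rule image_compactin[OF _ continuous_map_fst])
    moreover have "fst ` (R \<inter> {z \<in> topspace (prod_topology Y W). snd z \<in> C}) =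
        {y \<in> topspace (subtopology Y (fst ` R)). s y \<in> C}"
      unfolding top using s RZ by force
    ultimately have "closedin Y {y \<in> topspace (subtopology Y (fst ` R)). s y \<in> C}"
      using compactin_imp_closedin[OF Y] by simp
    then show "closedin (subtopology Y (fst ` R)) {y \<in> topspace (subtopology Y (fst ` R)). s y \<in> C}"
      by (rule closedin_subset_topspace) (use top in auto)
  qed
  then show ?thesis
    using s by (intro exI[of _ s]) simp
qed

lemma finite_set_as_tuple:
  assumes "finite K" "K \<subseteq> B"
  shows "\<exists>x \<in> {..<card K} \<rightarrow>\<^sub>E B. x ` {..<card K} = K"
proof -
  obtain h where h: "bij_betw h {0..<card K} K"
    using ex_bij_betw_nat_finite[OF assms(1)] by auto
  have "restrict h {..<card K} ` {..<card K} = K"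
    using h by (simp add: bij_betw_def lessThan_atLeast0)
  moreover have "restrict h {..<card K} \<in> {..<card K} \<rightarrow>\<^sub>E B"
    using h assms(2) by (auto simp: bij_betw_def lessThan_atLeast0)
  ultimately show ?thesis
    by blast
qed

lemma Hausdorff_finite_power: "Hausdorff_space X \<Longrightarrow> Hausdorff_space (finite_power X q)"
  unfolding finite_power_def by (simp add: Hausdorff_space_product_topology)

lemma metrizable_finite_power: "metrizable_space Y \<Longrightarrow> metrizable_space (finite_power Y r)"
  unfolding finite_power_def by (simp add: metrizable_space_product_topology countable_finite)

lemma compactin_cube: "compactin X B \<Longrightarrow> compactin (finite_power X q) ({..<q} \<rightarrow>\<^sub>E B)"
  unfolding finite_power_def by (simp add: compactin_PiE)

text \<open>
The maps of the list together form a map into the power of \<open>X\<close> whose exponent is the length of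
the list. Lists rather than maps into powers are used because the maps belonging to several factors
of a product are then joined by concatenation.
\<close>

definition finitely_parametrised :: "'a topology \<Rightarrow> 'b topology \<Rightarrow> 'b set \<Rightarrow> bool" where
  "finitely_parametrised X Y C \<longleftrightarrow> compactin Y C \<and>
     (\<exists>us k. (\<forall>u\<in>set us. continuous_map (subtopology Y C) X u) \<and>
        (\<forall>y\<in>C. finite {y' \<in> C. \<forall>u\<in>set us. u y' = u y} \<and>
                card {y' \<in> C. \<forall>u\<in>set us. u y' = u y} \<le> k))"

context good_surjection
begin

lemma HausX: "Hausdorff_space X" and HausY: "Hausdorff_space Y"
  using metX metY metrizable_imp_Hausdorff_space by auto

lemma compactin_controls_graph:
  assumes L: "compactin Y L" and B: "compactin X B"
  shows "compactin (prod_topology Y (finite_power X q))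
           {z \<in> L \<times> ({..<q} \<rightarrow>\<^sub>E B). controls p (fst z) (snd z ` {..<q})}"
proof -
  let ?Z = "prod_topology Y (finite_power X q)"
  have "compactin ?Z (L \<times> ({..<q} \<rightarrow>\<^sub>E B))"
    using L compactin_cube[OF B] by (simp add: compactin_Times)
  then have "compactin ?Z ((L \<times> ({..<q} \<rightarrow>\<^sub>E B)) \<inter>
      {z \<in> topspace ?Z. controls p (fst z) (snd z ` {..<q})})"
    using closedin_controls by (rule compact_Int_closedin)
  moreover have "L \<times> ({..<q} \<rightarrow>\<^sub>E B) \<subseteq> topspace ?Z"
    using \<open>compactin ?Z (L \<times> _)\<close> by (rule compactin_subset_topspace)
  then have "(L \<times> ({..<q} \<rightarrow>\<^sub>E B)) \<inter> {z \<in> topspace ?Z. controls p (fst z) (snd z ` {..<q})} =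
      {z \<in> L \<times> ({..<q} \<rightarrow>\<^sub>E B). controls p (fst z) (snd z ` {..<q})}"
    by (auto simp del: topspace_prod_topology)
  ultimately show ?thesis
    by simp
qed

text \<open>
The second bound is twice the first, because the intersection of two controls with bound \<open>p\<close> is a
control with bound \<open>2 * p\<close>.
\<close>

definition minimal_control :: "nat \<Rightarrow> nat \<Rightarrow> 'a set \<Rightarrow> 'b \<Rightarrow> bool" where
  "minimal_control p q B y \<longleftrightarrow>
     (\<exists>x \<in> {..<q} \<rightarrow>\<^sub>E B. controls (real p) y (x ` {..<q})) \<and>
     (\<forall>r<q. \<not> (\<exists>x \<in> {..<r} \<rightarrow>\<^sub>E B. controls (real (2 * p)) y (x ` {..<r})))"

text \<open>
The intersection of the two controls is a control with bound \<open>2 * p\<close>, hence has at least \<open>q\<close>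
points, while each of the two has at most \<open>q\<close>.
\<close>

lemma minimal_control_unique:
  assumes y: "minimal_control p q B y" and B: "B \<subseteq> topspace X"
    and x: "x \<in> {..<q} \<rightarrow>\<^sub>E B" "controls (real p) y (x ` {..<q})"
    and x': "x' \<in> {..<q} \<rightarrow>\<^sub>E B" "controls (real p) y (x' ` {..<q})"
  shows "card (x ` {..<q}) = q" "x' ` {..<q} = x ` {..<q}"
proof -
  have sub: "x ` {..<q} \<subseteq> B" "x' ` {..<q} \<subseteq> B"
    using x(1) x'(1) by auto
  have large: "q \<le> card K" if K: "finite K" "K \<subseteq> B" "controls (real (2 * p)) y K" for K
  proof (rule ccontr)
    assume "\<not> q \<le> card K"
    moreover obtain v where "v \<in> {..<card K} \<rightarrow>\<^sub>E B" "v ` {..<card K} = K"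
      using finite_set_as_tuple[OF K(1,2)] by blast
    ultimately show False
      using y K(3) unfolding minimal_control_def by (metis not_le)
  qed
  have "controls (real p + real p) y (x ` {..<q} \<inter> x' ` {..<q})"
    using sub B x(2) x'(2) by (intro controls_Int) auto
  then have int: "q \<le> card (x ` {..<q} \<inter> x' ` {..<q})"
    using sub by (intro large) auto
  have le: "card (x ` {..<q}) \<le> q" "card (x' ` {..<q}) \<le> q"
    using card_image_le[of "{..<q}" x] card_image_le[of "{..<q}" x'] by simp_all
  have "card (x ` {..<q} \<inter> x' ` {..<q}) \<le> card (x ` {..<q})"
    by (intro card_mono) auto
  then show card: "card (x ` {..<q}) = q"
    using int le by linarith
  have "x ` {..<q} \<inter> x' ` {..<q} = x ` {..<q}"
    using int card by (intro card_seteq) auto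
  moreover have "x ` {..<q} \<inter> x' ` {..<q} = x' ` {..<q}"
    using int le by (intro card_seteq) auto
  ultimately show "x' ` {..<q} = x ` {..<q}"
    by simp
qed

text \<open>
The control of \<open>y\<close> is unique as a set but not as a tuple, since its points can be permuted. To choose
one of the tuples continuously, label the points of a given control by a continuous function \<open>h\<close>
with value \<open>j\<close> at the \<open>j\<close>-th point. Among the tuples that enumerate the same set, at most one
has all its labels within \<open>1/3\<close> of the positions, and this is a closed condition. By compactness
finitely many such functions \<open>h\<close> suffice.
\<close>

lemma compact_minimal_control_pieces:
  assumes G: "compactin Y G" and B: "compactin X B" and min: "\<And>y. y \<in> G \<Longrightarrow> minimal_control p q B y"
  shows "\<exists>\<C>. finite \<C> \<and> G \<subseteq> \<Union>\<C> \<and> (\<forall>C\<in>\<C>. finitely_parametrised X Y C)"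
proof -
  let ?Z = "prod_topology Y (finite_power X q)"
  define R where "R = {z \<in> G \<times> ({..<q} \<rightarrow>\<^sub>E B). controls (real p) (fst z) (snd z ` {..<q})}"
  have R_iff: "z \<in> R \<longleftrightarrow> fst z \<in> G \<and> snd z \<in> {..<q} \<rightarrow>\<^sub>E B \<and>
      controls (real p) (fst z) (snd z ` {..<q})" for z
    unfolding R_def mem_Collect_eq mem_Times_iff by blast
  have R: "compactin ?Z R"
    unfolding R_def by (rule compactin_controls_graph[OF G B])
  have RZ: "R \<subseteq> topspace ?Z"
    using R by (rule compactin_subset_topspace)
  have BX: "B \<subseteq> topspace X"
    using B by (rule compactin_subset_topspace)
  have proj: "continuous_map ?Z X (\<lambda>z. snd z j)" if j: "j \<in> {..<q}" for j
    using continuous_map_compose[OF continuous_map_snd, of "finite_power X q" X "\<lambda>x. x j"]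
      continuous_map_product_projection[OF j, of "\<lambda>_. X"] unfolding finite_power_def o_def by blast
  define dev where "dev h z j = \<bar>h (snd z j) - real j\<bar>" for h :: "'a \<Rightarrow> real" and z :: "'b \<times> (nat \<Rightarrow> 'a)" and j
  have dev_cont: "continuous_map ?Z euclideanreal (\<lambda>z. dev h z j)"
    if "continuous_map X euclideanreal h" "j \<in> {..<q}" for h j
    unfolding dev_def
    by (intro continuous_map_real_abs continuous_map_diff
          continuous_map_compose[OF proj[OF that(2)] that(1), unfolded o_def]) simp
  define near where "near h = (\<Inter>j\<in>{..<q}. {z \<in> topspace ?Z. dev h z j < 1/3}) \<inter> topspace ?Z" for h
  define cnear where "cnear h = \<Inter>(insert (topspace ?Z) ((\<lambda>j. {z \<in> topspace ?Z. dev h z j \<le> 1/3}) ` {..<q}))" for h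
  have near_open: "openin ?Z (near h)" if "continuous_map X euclideanreal h" for h
    unfolding near_def
  proof (rule openin_INT)
    fix j assume "j \<in> {..<q}"
    from openin_continuous_map_preimage[OF dev_cont[OF that this], of "{..<1/3}"]
    show "openin ?Z {z \<in> topspace ?Z. dev h z j < 1/3}" by simp
  qed simp
  have cnear_closed: "closedin ?Z (cnear h)" if "continuous_map X euclideanreal h" for h
  proof -
    have "closedin ?Z {z \<in> topspace ?Z. dev h z j \<le> 1/3}" if "j \<in> {..<q}" for j
      using closedin_continuous_map_preimage[OF dev_cont[OF \<open>continuous_map X euclideanreal h\<close> that], of "{..1/3}"]
      by simp
    then show ?thesis
      unfolding cnear_def
      by (intro closedin_Inter) (auto simp del: topspace_prod_topology intro: closedin_topspace)
  qed
  have cnearD: "dev h z j \<le> 1/3" if "z \<in> cnear h" "j < q" for h z j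
    using that unfolding cnear_def by auto
  have near_cnear: "near h \<subseteq> cnear h" for h
    unfolding near_def cnear_def by (auto simp del: topspace_prod_topology intro: less_imp_le)
  have "\<exists>h. continuous_map X euclideanreal h \<and> z \<in> near h" if z: "z \<in> R" for z
  proof -
    have zz: "fst z \<in> G" "snd z \<in> {..<q} \<rightarrow>\<^sub>E B" "controls (real p) (fst z) (snd z ` {..<q})"
      using z unfolding R_iff Int_iff by blast+
    have "card (snd z ` {..<q}) = q"
      using minimal_control_unique(1)[OF min[OF zz(1)] BX zz(2,3) zz(2,3)] .
    then have inj: "inj_on (snd z) {..<q}"
      by (intro eq_card_imp_inj_on) auto
    have "\<exists>h. continuous_map X euclideanreal h \<and> (\<forall>x\<in>topspace X. h x \<in> {0..real q}) \<and>
        (\<forall>x\<in>snd z ` {..<q}. h x = real (inv_into {..<q} (snd z) x))"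
    proof (rule finite_interpolation[OF metX])
      show "snd z ` {..<q} \<subseteq> topspace X"
        using zz(2) BX by auto
      show "real (inv_into {..<q} (snd z) x) \<in> {0..real q}" if "x \<in> snd z ` {..<q}" for x
        using inv_into_into[OF that] by simp
    qed auto
    then obtain h where h: "continuous_map X euclideanreal h"
        "\<forall>x\<in>snd z ` {..<q}. h x = real (inv_into {..<q} (snd z) x)"
      by (elim exE conjE) (rule that)
    have "dev h z j = 0" if "j < q" for j
      using h(2) that inj unfolding dev_def by simp
    then have "z \<in> near h"
      using z RZ unfolding near_def by (auto simp del: topspace_prod_topology)
    then show ?thesis
      using h(1) by blast
  qed
  then have "R \<subseteq> \<Union>(near ` {h. continuous_map X euclideanreal h})"
    by blast
  then have "\<exists>\<F>. finite \<F> \<and> \<F> \<subseteq> near ` {h. continuous_map X euclideanreal h} \<and> R \<subseteq> \<Union>\<F>"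
    using near_open by (intro compactinD[OF R]) auto
  then obtain \<F> where \<F>: "finite \<F>" "\<F> \<subseteq> near ` {h. continuous_map X euclideanreal h}" "R \<subseteq> \<Union>\<F>"
    by (elim exE conjE) (rule that)
  obtain \<H> where \<H>: "\<H> \<subseteq> {h. continuous_map X euclideanreal h}" "finite \<H>" "\<F> = near ` \<H>"
    using finite_subset_image[OF \<F>(1,2)] by blast
  define piece where "piece h = fst ` (R \<inter> cnear h)" for h
  have "finitely_parametrised X Y (piece h)" if "h \<in> \<H>" for h
  proof -
    have h: "continuous_map X euclideanreal h"
      using that \<H>(1) by blast
    have Rh: "compactin ?Z (R \<inter> cnear h)"
      using R cnear_closed[OF h] by (rule compact_Int_closedin)
    have "inj_on fst (R \<inter> cnear h)"
    proof (rule inj_onI)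
      fix z z' assume z: "z \<in> R \<inter> cnear h" and z': "z' \<in> R \<inter> cnear h" and eq: "fst z = fst z'"
      have zz: "fst z \<in> G" "snd z \<in> {..<q} \<rightarrow>\<^sub>E B" "controls (real p) (fst z) (snd z ` {..<q})"
        using z unfolding R_iff Int_iff by blast+
      have zz': "snd z' \<in> {..<q} \<rightarrow>\<^sub>E B" "controls (real p) (fst z) (snd z' ` {..<q})"
        using z' unfolding R_iff Int_iff eq by blast+
      have img: "snd z' ` {..<q} = snd z ` {..<q}"
        using minimal_control_unique(2)[OF min[OF zz(1)] BX zz(2,3) zz'] .
      have "snd z j = snd z' j" if j: "j < q" for j
      proof -
        have "snd z j \<in> snd z' ` {..<q}"
          unfolding img using j by simp
        then obtain i where i: "i < q" "snd z j = snd z' i"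
          by auto
        have "dev h z j \<le> 1/3" "dev h z' i \<le> 1/3"
          using cnearD z z' j i(1) by auto
        then have "\<bar>real i - real j\<bar> < 1"
          unfolding dev_def i(2) by linarith
        then have "i = j"
          by linarith
        then show ?thesis
          using i(2) by simp
      qed
      then have "snd z = snd z'"
        using zz(2) zz'(1) by (intro PiE_ext[of "snd z" "{..<q}" "\<lambda>_. B"]) auto
      then show "z = z'"
        using eq by (simp add: prod_eq_iff)
    qed
    then have "\<exists>s. continuous_map (subtopology Y (piece h)) (finite_power X q) s \<and>
        (\<forall>z\<in>R \<inter> cnear h. s (fst z) = snd z)"
      unfolding piece_def
      by (intro compact_graph_selection[OF HausY Hausdorff_finite_power[OF HausX] Rh])
    then obtain s where s: "continuous_map (subtopology Y (piece h)) (finite_power X q) s"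
        "\<forall>z\<in>R \<inter> cnear h. s (fst z) = snd z"
      by (elim exE conjE) (rule that)
    have s_val: "controls (real p) y (s y ` {..<q})" "s y \<in> {..<q} \<rightarrow>\<^sub>E B" if y: "y \<in> piece h" for y
    proof -
      obtain z where z: "z \<in> R \<inter> cnear h" "y = fst z"
        using y unfolding piece_def by blast
      then have "s y = snd z"
        using s(2) by blast
      then show "controls (real p) y (s y ` {..<q})" "s y \<in> {..<q} \<rightarrow>\<^sub>E B"
        using z unfolding R_iff Int_iff by simp_all
    qed
    define us where "us = map (\<lambda>j y. s y j) [0..<q]"
    have us_iff: "(\<forall>u\<in>set us. u y' = u y) \<longleftrightarrow> (\<forall>j<q. s y' j = s y j)" for y y'
      unfolding us_def by auto
    have us_cont: "\<forall>u\<in>set us. continuous_map (subtopology Y (piece h)) X u"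
    proof
      fix u assume "u \<in> set us"
      then obtain j where j: "j \<in> {..<q}" "u = (\<lambda>y. s y j)"
        unfolding us_def by auto
      show "continuous_map (subtopology Y (piece h)) X u"
        using continuous_map_compose[OF s(1)[unfolded finite_power_def]
            continuous_map_product_projection[OF j(1), of "\<lambda>_. X"]]
        unfolding j(2) o_def by simp
    qed
    have pieceY: "compactin Y (piece h)"
      unfolding piece_def using Rh continuous_map_fst by (rule image_compactin)
    then have pieceY': "piece h \<subseteq> topspace Y"
      by (rule compactin_subset_topspace)
    obtain k where k: "\<forall>K. finite K \<and> K \<subseteq> topspace X \<and> card K \<le> q \<longrightarrow>
        finite {y \<in> topspace Y. controls (real p) y K} \<and>
        card {y \<in> topspace Y. controls (real p) y K} \<le> k"
      using controlled_points_bounded[of q "real p"] by (elim exE) (rule that)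
    have "finite {y' \<in> piece h. \<forall>u\<in>set us. u y' = u y} \<and>
        card {y' \<in> piece h. \<forall>u\<in>set us. u y' = u y} \<le> k" if y: "y \<in> piece h" for y
    proof -
      let ?K = "s y ` {..<q}"
      have "?K \<subseteq> topspace X"
        using s_val(2)[OF y] BX by auto
      moreover have "card ?K \<le> q"
        using card_image_le[of "{..<q}" "s y"] by simp
      ultimately have K: "finite {y \<in> topspace Y. controls (real p) y ?K}"
          "card {y \<in> topspace Y. controls (real p) y ?K} \<le> k"
        using k by auto
      have sub: "{y' \<in> piece h. \<forall>u\<in>set us. u y' = u y} \<subseteq> {y \<in> topspace Y. controls (real p) y ?K}"
      proof
        fix y' assume "y' \<in> {y' \<in> piece h. \<forall>u\<in>set us. u y' = u y}"
        then have y': "y' \<in> piece h" "\<forall>j<q. s y' j = s y j"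
          unfolding us_iff by auto
        then have "s y' ` {..<q} = ?K"
          by (intro image_cong) auto
        then show "y' \<in> {y \<in> topspace Y. controls (real p) y ?K}"
          using s_val(1)[OF y'(1)] y'(1) pieceY' by auto
      qed
      show ?thesis
        by (intro conjI finite_subset[OF sub K(1)] order_trans[OF card_mono[OF K(1) sub] K(2)])
    qed
    then show ?thesis
      unfolding finitely_parametrised_def using pieceY us_cont
      by (intro conjI exI[of _ us] exI[of _ k] ballI) simp_all
  qed
  moreover have "G \<subseteq> \<Union>(piece ` \<H>)"
  proof
    fix y assume y: "y \<in> G"
    then obtain x where x: "x \<in> {..<q} \<rightarrow>\<^sub>E B" "controls (real p) y (x ` {..<q})"
      using min unfolding minimal_control_def by blast
    then have "(y, x) \<in> R"
      using y unfolding R_iff by simp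
    then obtain h where "h \<in> \<H>" "(y, x) \<in> near h"
      using \<F>(3) unfolding \<H>(3) by blast
    then have "h \<in> \<H>" "(y, x) \<in> R \<inter> cnear h"
      using \<open>(y, x) \<in> R\<close> near_cnear by blast+
    then show "y \<in> \<Union>(piece ` \<H>)"
      unfolding piece_def by force
  qed
  ultimately show ?thesis
    using \<H>(2) by (intro exI[of _ "piece ` \<H>"]) auto
qed

text \<open>
The points with a control of a prescribed size and bound in \<open>B\<close> form a compact set. Having a minimal
control thus defines in \<open>L\<close> the difference of two compact sets, which in a metrizable space is a countable
union of compact sets.
\<close>

lemma minimal_control_pieces:
  assumes L: "compactin Y L" and B: "compactin X B"
  shows "\<exists>\<C>. countable \<C> \<and> {y \<in> L. minimal_control p q B y} \<subseteq> \<Union>\<C> \<and>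
           (\<forall>C\<in>\<C>. finitely_parametrised X Y C)"
proof -
  define M where "M p r = fst ` {z \<in> L \<times> ({..<r} \<rightarrow>\<^sub>E B). controls p (fst z) (snd z ` {..<r})}" for p and r :: nat
  have M: "compactin Y (M p r)" for p r
    unfolding M_def by (rule image_compactin[OF compactin_controls_graph[OF L B] continuous_map_fst])
  have M_iff: "y \<in> M p r \<longleftrightarrow> y \<in> L \<and> (\<exists>x\<in>{..<r} \<rightarrow>\<^sub>E B. controls p y (x ` {..<r}))" for y p r
    unfolding M_def by force
  define M' where "M' = (\<Union>r\<in>{..<q}. M (real (2 * p)) r)"
  have "closedin Y M'"
    unfolding M'_def using compactin_imp_closedin[OF HausY M] by (intro closedin_Union) auto
  then have "openin Y (topspace Y - M')"
    by blast
  then have "fsigma_in Y (topspace Y - M')"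
    by (rule open_imp_fsigma_in[OF metY])
  then obtain Cl :: "nat \<Rightarrow> 'b set" where Cl: "\<And>n. closedin Y (Cl n)" "\<Union>(range Cl) = topspace Y - M'"
    unfolding fsigma_in_ascending by auto
  have min: "minimal_control p q B y" if "y \<in> M (real p) q \<inter> Cl n" for y n
  proof -
    have "y \<in> Cl n" "y \<in> L" "\<exists>x\<in>{..<q} \<rightarrow>\<^sub>E B. controls (real p) y (x ` {..<q})"
      using that unfolding Int_iff M_iff by blast+
    moreover have "y \<notin> M'"
      using Cl(2) \<open>y \<in> Cl n\<close> by blast
    ultimately show ?thesis
      unfolding minimal_control_def M'_def UN_iff M_iff by blast
  qed
  have "\<exists>\<C>. finite \<C> \<and> M (real p) q \<inter> Cl n \<subseteq> \<Union>\<C> \<and> (\<forall>C\<in>\<C>. finitely_parametrised X Y C)" for n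
    using min by (intro compact_minimal_control_pieces[OF compact_Int_closedin[OF M Cl(1)] B])
  then obtain \<C> where \<C>: "\<And>n. finite (\<C> n) \<and> M (real p) q \<inter> Cl n \<subseteq> \<Union>(\<C> n) \<and>
      (\<forall>C\<in>\<C> n. finitely_parametrised X Y C)"
    by metis
  have "{y \<in> L. minimal_control p q B y} \<subseteq> \<Union>(\<Union>n. \<C> n)"
  proof
    fix y assume "y \<in> {y \<in> L. minimal_control p q B y}"
    then have y: "y \<in> L" "minimal_control p q B y"
      by auto
    have "y \<in> M (real p) q" "y \<notin> M'"
      using y unfolding minimal_control_def M'_def UN_iff M_iff by auto
    moreover have "y \<in> topspace Y"
      using y(1) compactin_subset_topspace[OF L] by blast
    ultimately obtain n where "y \<in> M (real p) q \<inter> Cl n"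
      using Cl(2) by blast
    then show "y \<in> \<Union>(\<Union>n. \<C> n)"
      using \<C>[of n] by blast
  qed
  moreover have "countable (\<Union>n. \<C> n)"
    using \<C> by (intro countable_UN) (auto intro: countable_finite)
  ultimately show ?thesis
    using \<C> by (intro exI[of _ "\<Union>n. \<C> n"]) simp
qed

end

lemma sigma_compact_directed:
  assumes "sigma_compact_space X"
  shows "\<exists>K :: nat \<Rightarrow> 'a set. (\<forall>n. compactin X (K n)) \<and> (\<Union>n. K n) = topspace X \<and>
           (\<forall>A. finite A \<and> A \<subseteq> topspace X \<longrightarrow> (\<exists>n. A \<subseteq> K n))"
proof -
  obtain C :: "nat \<Rightarrow> 'a set" where C: "\<And>n. compactin X (C n)" "(\<Union>n. C n) = topspace X"
    using assms unfolding sigma_compact_space_def by auto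
  define K where "K n = (\<Union>i\<in>{..n}. C i)" for n
  have "compactin X (K n)" for n
    unfolding K_def using C(1) by (intro compactin_Union) auto
  moreover have U: "(\<Union>n. K n) = topspace X"
    unfolding K_def using C(2) by auto
  moreover have "\<exists>n. A \<subseteq> K n" if "finite A" "A \<subseteq> topspace X" for A
    using that
  proof (induction A rule: finite_induct)
    case (insert a A)
    then obtain n where n: "A \<subseteq> K n" by blast
    obtain i where "a \<in> C i"
      using C(2) insert.prems by blast
    then have "insert a A \<subseteq> K (max i n)"
      using n unfolding K_def by fastforce
    then show ?case ..
  qed simp
  ultimately show ?thesis
    by (intro exI[of _ K]) simp
qed

text \<open>
Let \<open>q\<close> be the least size of a control of \<open>y\<close>, for any bound and any compact set of the exhaustion of
\<open>X\<close>. A control of this size is minimal, whatever its bound is, since no smaller set controls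
\<open>y\<close> with any bound.
\<close>

lemma (in good_surjection) countable_finitely_parametrised_cover:
  assumes "sigma_compact_space X" "sigma_compact_space Y"
  shows "\<exists>\<C>. countable \<C> \<and> topspace Y \<subseteq> \<Union>\<C> \<and> (\<forall>C\<in>\<C>. finitely_parametrised X Y C)"
proof -
  obtain Xs :: "nat \<Rightarrow> 'a set" where Xs: "\<forall>n. compactin X (Xs n)" "(\<Union>n. Xs n) = topspace X"
      "\<forall>A. finite A \<and> A \<subseteq> topspace X \<longrightarrow> (\<exists>n. A \<subseteq> Xs n)"
    using sigma_compact_directed[OF assms(1)] by (elim exE conjE) (rule that)
  obtain Ys :: "nat \<Rightarrow> 'b set" where Ys: "\<And>n. compactin Y (Ys n)" "(\<Union>n. Ys n) = topspace Y"
    using assms(2) unfolding sigma_compact_space_def by auto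
  have "\<exists>\<C>. countable \<C> \<and> {y \<in> Ys j. minimal_control p q (Xs n) y} \<subseteq> \<Union>\<C> \<and>
           (\<forall>C\<in>\<C>. finitely_parametrised X Y C)" for j p q n
    using Ys(1) Xs(1) by (intro minimal_control_pieces) auto
  \<comment> \<open>one index v = (j, p, q, n) for all choices of the two compact sets, the bound and the size\<close>
  then have "\<exists>\<C>. \<forall>v. countable (\<C> v) \<and>
      {y \<in> Ys (fst v). minimal_control (fst (snd v)) (fst (snd (snd v))) (Xs (snd (snd (snd v)))) y} \<subseteq> \<Union>(\<C> v) \<and>
      (\<forall>C\<in>\<C> v. finitely_parametrised X Y C)"
    by (intro choice allI)
  then obtain \<C> where \<C>: "\<forall>v. countable (\<C> v) \<and>
      {y \<in> Ys (fst v). minimal_control (fst (snd v)) (fst (snd (snd v))) (Xs (snd (snd (snd v)))) y} \<subseteq> \<Union>(\<C> v) \<and>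
      (\<forall>C\<in>\<C> v. finitely_parametrised X Y C)"
    by (elim exE) (rule that)
  have "topspace Y \<subseteq> \<Union>(\<Union>v. \<C> v)"
  proof
    fix y assume y: "y \<in> topspace Y"
    define P where "P q \<longleftrightarrow> (\<exists>n (p::nat). \<exists>x\<in>{..<q} \<rightarrow>\<^sub>E Xs n. controls (real p) y (x ` {..<q}))" for q :: nat
    obtain N :: nat and K where K: "finite K" "K \<subseteq> topspace X" "controls (real N) y K"
      using exists_controls[OF y] by (elim exE conjE) (rule that)
    obtain n where "K \<subseteq> Xs n"
      using Xs(3) K(1,2) by blast
    then have "P (card K)"
      using finite_set_as_tuple[OF K(1)] K(3) unfolding P_def by metis
    then have "P (LEAST q. P q)"
      by (rule LeastI)
    have least: "\<not> P r" if "r < (LEAST q. P q)" for r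
      using that by (rule not_less_Least)
    define q where "q = (LEAST q. P q)"
    have "P q"
      unfolding q_def by fact
    then obtain n p where np: "\<exists>x\<in>{..<q} \<rightarrow>\<^sub>E Xs n. controls (real p) y (x ` {..<q})"
      unfolding P_def by (elim exE) (rule that)
    have "\<not> (\<exists>x\<in>{..<r} \<rightarrow>\<^sub>E Xs n. controls (real (2 * p)) y (x ` {..<r}))" if "r < q" for r
    proof -
      have "\<not> P r"
        using that unfolding q_def by (rule least)
      then show ?thesis
        unfolding P_def by blast
    qed
    then have "minimal_control p q (Xs n) y"
      using np unfolding minimal_control_def by blast
    moreover obtain j where "y \<in> Ys j"
      using y Ys(2) by blast
    ultimately have "y \<in> \<Union>(\<C> (j, p, q, n))"
      using \<C>[rule_format, of "(j, p, q, n)"] by auto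
    then show "y \<in> \<Union>(\<Union>v. \<C> v)"
      by blast
  qed
  moreover have "countable (\<Union>v. \<C> v)"
    using \<C> by (intro countable_UN) auto
  moreover have "\<forall>C\<in>\<Union>v. \<C> v. finitely_parametrised X Y C"
    using \<C> by blast
  ultimately show ?thesis
    by (intro exI[of _ "\<Union>v. \<C> v"] conjI)
qed

section \<open>Finite powers\<close>

lemma mC_on_singleton: "mC_on m Z {z}"
proof (rule mC_onI)
  fix G :: "nat \<Rightarrow> 'a set set" assume G: "\<And>i. small_open_cover m Z {z} (G i)"
  have "\<exists>U. U \<in> G i \<and> openin Z U \<and> z \<in> U" for i
    using G[of i] unfolding small_open_cover_def by blast
  then obtain U where U: "\<And>i. U i \<in> G i \<and> openin Z (U i) \<and> z \<in> U i"
    by metis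
  have "disjoint_refinement Z {U i} (G i)" for i
    using U[of i] unfolding disjoint_refinement_def by auto
  then show "\<exists>H. (\<forall>i. disjoint_refinement Z (H i) (G i)) \<and> {z} \<subseteq> \<Union>(\<Union>i. H i)"
    using U by (intro exI[of _ "\<lambda>i. {U i}"]) simp
qed

text \<open>
The coordinate maps of all factors together form a continuous map from the product into a power of
\<open>X\<close>, whose fibres lie in products of fibres of the factors. This is why the hypothesis concerns all
finite powers of \<open>X\<close> even if only one power of \<open>Y\<close> is considered.
\<close>

lemma mC_on_product_of_parametrised:
  fixes X :: "'a topology" and Y :: "'b topology"
  assumes metY: "metrizable_space Y" and HausX: "Hausdorff_space X"
    and mC: "\<And>q. mC_on m (finite_power X q) (topspace (finite_power X q))"
    and C: "\<And>i. i < r \<Longrightarrow> finitely_parametrised X Y (C i)"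
  shows "mC_on m (finite_power Y r) (PiE {..<r} C)"
proof -
  have "\<exists>us k. (\<forall>u\<in>set us. continuous_map (subtopology Y (C i)) X u) \<and>
        (\<forall>y\<in>C i. finite {y' \<in> C i. \<forall>u\<in>set us. u y' = u y} \<and>
                card {y' \<in> C i. \<forall>u\<in>set us. u y' = u y} \<le> k)" if "i < r" for i
    using C[OF that] unfolding finitely_parametrised_def by blast
  then have "\<exists>us. \<forall>i. i < r \<longrightarrow> (\<exists>k. (\<forall>u\<in>set (us i). continuous_map (subtopology Y (C i)) X u) \<and>
        (\<forall>y\<in>C i. finite {y' \<in> C i. \<forall>u\<in>set (us i). u y' = u y} \<and>
                card {y' \<in> C i. \<forall>u\<in>set (us i). u y' = u y} \<le> k))"
    by (intro choice) blast
  then obtain us where "\<forall>i. i < r \<longrightarrow> (\<exists>k. (\<forall>u\<in>set (us i). continuous_map (subtopology Y (C i)) X u) \<and>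
        (\<forall>y\<in>C i. finite {y' \<in> C i. \<forall>u\<in>set (us i). u y' = u y} \<and>
                card {y' \<in> C i. \<forall>u\<in>set (us i). u y' = u y} \<le> k))"
    by (elim exE) (rule that)
  then have "\<exists>k. \<forall>i. i < r \<longrightarrow> (\<forall>u\<in>set (us i). continuous_map (subtopology Y (C i)) X u) \<and>
        (\<forall>y\<in>C i. finite {y' \<in> C i. \<forall>u\<in>set (us i). u y' = u y} \<and>
                card {y' \<in> C i. \<forall>u\<in>set (us i). u y' = u y} \<le> k i)"
    by (intro choice) blast
  then obtain k where usk: "\<forall>i. i < r \<longrightarrow> (\<forall>u\<in>set (us i). continuous_map (subtopology Y (C i)) X u) \<and>
        (\<forall>y\<in>C i. finite {y' \<in> C i. \<forall>u\<in>set (us i). u y' = u y} \<and>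
                card {y' \<in> C i. \<forall>u\<in>set (us i). u y' = u y} \<le> k i)"
    by (elim exE) (rule that)
  let ?F = "PiE {..<r} C"
  define fib where "fib i y = {y' \<in> C i. \<forall>u\<in>set (us i). u y' = u y}" for i y
  have us_cont: "continuous_map (subtopology Y (C i)) X u" if "i < r" "u \<in> set (us i)" for i u
    using usk that by blast
  have fib: "finite (fib i y)" "card (fib i y) \<le> k i" if "i < r" "y \<in> C i" for i y
    using usk that unfolding fib_def by blast+
  define vs where "vs = concat (map (\<lambda>i. map (\<lambda>u z. u (z i)) (us i)) [0..<r])"
  have vs: "set vs = (\<Union>i<r. (\<lambda>u z. u (z i)) ` set (us i))"
    unfolding vs_def by (simp add: atLeast0LessThan)
  define \<phi> where "\<phi> z = (\<lambda>j\<in>{..<length vs}. (vs ! j) z)" for z :: "nat \<Rightarrow> 'b"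
  have CY: "C i \<subseteq> topspace Y" "compactin Y (C i)" if "i < r" for i
    using C[OF that] compactin_subset_topspace unfolding finitely_parametrised_def by blast+
  have F: "compactin (finite_power Y r) ?F"
    unfolding finite_power_def using CY by (simp add: compactin_PiE)
  have FY: "?F \<subseteq> topspace (finite_power Y r)"
    using F by (rule compactin_subset_topspace)
  have topF: "topspace (subtopology (finite_power Y r) ?F) = ?F"
    using FY by (rule topspace_subtopology_subset)
  have v_cont: "continuous_map (subtopology (finite_power Y r) ?F) X v" if v: "v \<in> set vs" for v
  proof -
    obtain i u where iu: "i < r" "u \<in> set (us i)" "v = (\<lambda>z. u (z i))"
      using v unfolding vs by auto
    have "continuous_map (subtopology (finite_power Y r) ?F) Y (\<lambda>z. z i)"
      unfolding finite_power_def using iu(1)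
      by (intro continuous_map_from_subtopology continuous_map_product_projection) simp
    moreover have "(\<lambda>z. z i) \<in> topspace (subtopology (finite_power Y r) ?F) \<rightarrow> C i"
      unfolding topF using iu(1) by auto
    ultimately have "continuous_map (subtopology (finite_power Y r) ?F) (subtopology Y (C i)) (\<lambda>z. z i)"
      unfolding continuous_map_in_subtopology by blast
    from continuous_map_compose[OF this us_cont[OF iu(1,2)]]
    show ?thesis
      unfolding iu(3) o_def .
  qed
  have \<phi>: "continuous_map (subtopology (finite_power Y r) ?F) (finite_power X (length vs)) \<phi>"
    unfolding finite_power_def[of X] continuous_map_componentwise
  proof (intro conjI ballI)
    show "\<phi> ` topspace (subtopology (finite_power Y r) ?F) \<subseteq> extensional {..<length vs}"
      unfolding \<phi>_def by auto
    fix j assume j: "j \<in> {..<length vs}"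
    then have "(\<lambda>z. \<phi> z j) = vs ! j"
      unfolding \<phi>_def by auto
    then show "continuous_map (subtopology (finite_power Y r) ?F) X (\<lambda>z. \<phi> z j)"
      using v_cont[of "vs ! j"] j by simp
  qed
  have fibres: "finite {z' \<in> ?F. \<phi> z' = \<phi> z} \<and> card {z' \<in> ?F. \<phi> z' = \<phi> z} \<le> (\<Prod>i<r. k i)" if z: "z \<in> ?F" for z
  proof -
    have sub: "{z' \<in> ?F. \<phi> z' = \<phi> z} \<subseteq> (\<Pi>\<^sub>E i\<in>{..<r}. fib i (z i))"
    proof
      fix z' assume "z' \<in> {z' \<in> ?F. \<phi> z' = \<phi> z}"
      then have z': "z' \<in> ?F" "\<phi> z' = \<phi> z" by auto
      have v_eq: "v z' = v z" if "v \<in> set vs" for v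
      proof -
        have "\<exists>j<length vs. vs ! j = v"
          using that by (simp add: in_set_conv_nth)
        then show ?thesis
          using fun_cong[OF z'(2)] unfolding \<phi>_def by (metis lessThan_iff restrict_apply')
      qed
      have "z' i \<in> fib i (z i)" if "i < r" for i
      proof -
        have "u (z' i) = u (z i)" if "u \<in> set (us i)" for u
        proof -
          have "(\<lambda>z. u (z i)) \<in> set vs"
            unfolding vs using \<open>i < r\<close> that by blast
          from v_eq[OF this] show ?thesis .
        qed
        moreover have "z' i \<in> C i"
          using z'(1) \<open>i < r\<close> by auto
        ultimately show ?thesis
          unfolding fib_def by simp
      qed
      then show "z' \<in> (\<Pi>\<^sub>E i\<in>{..<r}. fib i (z i))"
        using z'(1) by (simp add: PiE_iff)
    qed
    have zi: "z i \<in> C i" if "i < r" for i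
      using z that by auto
    have fin: "finite (\<Pi>\<^sub>E i\<in>{..<r}. fib i (z i))"
      using fib(1) zi by (intro finite_PiE) auto
    have "card (\<Pi>\<^sub>E i\<in>{..<r}. fib i (z i)) = (\<Prod>i<r. card (fib i (z i)))"
      by (simp add: card_PiE)
    also have "\<dots> \<le> (\<Prod>i<r. k i)"
      using fib(2) zi by (intro prod_mono) auto
    finally have "card (\<Pi>\<^sub>E i\<in>{..<r}. fib i (z i)) \<le> (\<Prod>i<r. k i)" .
    then show ?thesis
      by (intro conjI finite_subset[OF sub fin] order_trans[OF card_mono[OF fin sub]])
  qed
  show ?thesis
    using metrizable_finite_power[OF metY] Hausdorff_finite_power[OF HausX] mC F \<phi> fibres
    by (rule mC_on_bounded_fibres)
qed

lemma (in good_surjection) mC_space_finite_power: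
  assumes sigma: "sigma_compact_space X" "sigma_compact_space Y"
    and mC: "\<And>n. n \<ge> 1 \<Longrightarrow> mC_space m (finite_power X n)"
  shows "mC_space m (finite_power Y r)"
proof -
  have X_powers: "mC_on m (finite_power X q) (topspace (finite_power X q))" for q
  proof (cases "q = 0")
    case True
    \<comment> \<open>the zeroth power is a single point and is the target when all factors have an empty list of coordinates\<close>
    have "topspace (finite_power X q) = {\<lambda>_. undefined}"
      unfolding finite_power_def True by simp
    then show ?thesis
      using mC_on_singleton by metis
  next
    case False
    then show ?thesis
      using mC[of q] unfolding mC_space_iff_mC_on by simp
  qed
  obtain \<C> where \<C>: "countable \<C>" "topspace Y \<subseteq> \<Union>\<C>" "\<forall>C\<in>\<C>. finitely_parametrised X Y C"
    using countable_finitely_parametrised_cover[OF sigma] by (elim exE conjE) (rule that)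
  define \<F> where "\<F> = PiE {..<r} ` ({..<r} \<rightarrow>\<^sub>E \<C>)"
  have "countable \<F>"
    unfolding \<F>_def using \<C>(1) by (intro countable_image countable_PiE) auto
  moreover have "mC_on m (finite_power Y r) F" if F: "F \<in> \<F>" for F
  proof -
    obtain C where C: "C \<in> {..<r} \<rightarrow>\<^sub>E \<C>" "F = PiE {..<r} C"
      using F unfolding \<F>_def by blast
    have "finitely_parametrised X Y (C i)" if "i < r" for i
      using C(1) \<C>(3) that by auto
    then show ?thesis
      unfolding C(2) by (intro mC_on_product_of_parametrised[OF metY HausX X_powers])
  qed
  ultimately have all: "mC_on m (finite_power Y r) (\<Union>\<F>)"
    by (rule mC_on_countable_Union)
  have "\<Union>\<F> = topspace (finite_power Y r)"
  proof
    show "\<Union>\<F> \<subseteq> topspace (finite_power Y r)"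
    proof
      fix z assume "z \<in> \<Union>\<F>"
      then obtain C where C: "C \<in> {..<r} \<rightarrow>\<^sub>E \<C>" "z \<in> PiE {..<r} C"
        unfolding \<F>_def by blast
      have "z i \<in> topspace Y" if "i < r" for i
      proof -
        have "C i \<in> \<C>" "z i \<in> C i"
          using C that by auto
        then show ?thesis
          using \<C>(3) compactin_subset_topspace unfolding finitely_parametrised_def by blast
      qed
      then show "z \<in> topspace (finite_power Y r)"
        using C(2) unfolding finite_power_def by (simp add: PiE_iff)
    qed
    show "topspace (finite_power Y r) \<subseteq> \<Union>\<F>"
    proof
      fix z assume "z \<in> topspace (finite_power Y r)"
      then have z: "z \<in> extensional {..<r}" "\<forall>i<r. z i \<in> topspace Y"
        unfolding finite_power_def by (auto simp: PiE_iff)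
      then have "\<forall>i. \<exists>C. i < r \<longrightarrow> C \<in> \<C> \<and> z i \<in> C"
        using \<C>(2) by blast
      then obtain C where C: "\<forall>i. i < r \<longrightarrow> C i \<in> \<C> \<and> z i \<in> C i"
        using choice by metis
      have "restrict C {..<r} \<in> {..<r} \<rightarrow>\<^sub>E \<C>"
        using C by auto
      moreover have "z \<in> PiE {..<r} (restrict C {..<r})"
        using z(1) C by (simp add: PiE_iff)
      ultimately show "z \<in> \<Union>\<F>"
        unfolding \<F>_def by blast
    qed
  qed
  then show ?thesis
    using all metrizable_imp_normal_space[OF metrizable_finite_power[OF metY]]
    unfolding mC_space_iff_mC_on by simp
qed

theorem theorem1p3:
  fixes X :: "'a topology" and Y :: "'b topology" and D :: fun_class
    and T :: "('a \<Rightarrow> real) \<Rightarrow> ('b \<Rightarrow> real)" and c :: real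
  assumes "metrizable_space X" and "sigma_compact_space X"
    and "metrizable_space Y" and "sigma_compact_space Y"
    and "T ` topspace (Dp D X) = topspace (Dp D Y)"
    and "uniformly_continuous_Dp D X Y T"
    and "c > 0" and "c_good D X Y c T"
  shows "((\<forall>n\<ge>1. weakly_infinite_dimensional (finite_power X n)) \<longrightarrow>
            (\<forall>n\<ge>1. weakly_infinite_dimensional (finite_power Y n))) \<and>
         (\<forall>m\<ge>2. (\<forall>n\<ge>1. mC_space m (finite_power X n)) \<longrightarrow>
            (\<forall>n\<ge>1. mC_space m (finite_power Y n)))"
proof -
  interpret good_surjection X Y D T c
    using assms by unfold_locales
  have powers: "mC_space m (finite_power Y r)" if "\<forall>n\<ge>1. mC_space m (finite_power X n)" for m r
    using mC_space_finite_power[OF assms(2,4)] that by blast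
  have "weakly_infinite_dimensional (finite_power Y r)"
    if "\<forall>n\<ge>1. weakly_infinite_dimensional (finite_power X n)" for r
    using powers[of 2 r] that weakly_infinite_dimensional_imp_mC_space_2
      mC_space_2_imp_weakly_infinite_dimensional by blast
  then show ?thesis
    using powers by blast
qed

end
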